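(* Let $f:\mathbb{R}\to\mathbb{R}$ be a smooth function with $f\ge 0$, $f'\le 0$ and $f''\ge 0$, and let $\mathbb{R}\times_f\mathbb{R}^2$ denote $\mathbb{R}\times\mathbb{R}^2$ with the Riemannian metric $dt^2+e^{2f(t)}(dx^2+dy^2)$. Let $\Sigma$ be a compact graph over a domain of $\mathbb{R}^2$ in $\mathbb{R}\times_f\mathbb{R}^2$. Suppose that $\Sigma$ has positive constant mean curvature $H$ and that its boundary $\partial\Sigma$ is contained in the slice $\{0\}\times\mathbb{R}^2$. Then the height function $h:\Sigma\to\mathbb{R}$ satisfies $$h(p)\le \frac{e^{f(0)}}{H}\qquad\text{for every } p\in\Sigma.$$
   Context: Points of $\mathbb{R}\times_f\mathbb{R}^2$ are written $(t,q)$ with $t\in\mathbb{R}$, $q=(x,y)\in\mathbb{R}^2$. A graph over a domain of $\mathbb{R}^2$ is a surface of the form $\{(u(q),q)\}$ with $q$ ranging over the domain; here it is compact, with boundary. The height function is $h=\pi_1|_\Sigma$, where $\pi_1(t,q)=t$. The surface is oriented by a unit normal field $N$; with $\overline\nabla$ the Levi-Civita connection of the ambient metric, the shape operator $S$ is defined by $\overline\nabla_XN=-SX$, and the mean curvature is $H=\tfrac12\operatorname{tr}S$. Positive mean curvature means $H>0$ for the given orientation $N$. *)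

theory Defs
  imports "HOL-Analysis.Analysis"
begin

section \<open>Smooth maps\<close>

text \<open>Meant for open \<open>U\<close> only: the derivatives are taken in the full space.\<close>

primrec Ck_on :: "nat \<Rightarrow> 'a::euclidean_space set \<Rightarrow> ('a \<Rightarrow> 'b::real_normed_vector) \<Rightarrow> bool" where
  "Ck_on 0 U F = continuous_on U F"
| "Ck_on (Suc k) U F =
     ((\<forall>x\<in>U. F differentiable at x) \<and>
      (\<forall>v. Ck_on k U (\<lambda>x. frechet_derivative F (at x) v)))"

definition smooth_on :: "'a::euclidean_space set \<Rightarrow> ('a \<Rightarrow> 'b::real_normed_vector) \<Rightarrow> bool" where
  "smooth_on U F \<longleftrightarrow> (\<forall>k. Ck_on k U F)"

text \<open>Smoothness of a map given on an arbitrary subset of a Euclidean space.\<close>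

definition smooth_along :: "'a::euclidean_space set \<Rightarrow> ('a \<Rightarrow> 'b::real_normed_vector) \<Rightarrow> bool" where
  "smooth_along S F \<longleftrightarrow>
     (\<exists>W G. open W \<and> S \<subseteq> W \<and> smooth_on W G \<and> (\<forall>p\<in>S. G p = F p))"

section \<open>Embedded surfaces with boundary\<close>

definition half_plane :: "(real \<times> real) set" where
  "half_plane = {a. snd a \<ge> 0}"

text \<open>Parametrizations are defined on relatively open subsets \<open>U \<inter> half_plane\<close> of the
  half-plane, with \<open>\<phi>\<close> smooth and immersive on the open set \<open>U\<close> of the plane. Interior
  parametrizations are those for which \<open>U\<close> misses the line \<open>snd a = 0\<close>.\<close>

definition local_parametrization ::
  "'a::euclidean_space set \<Rightarrow> (real \<times> real) set \<Rightarrow> (real \<times> real \<Rightarrow> 'a) \<Rightarrow> bool" where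
  "local_parametrization S U \<phi> \<longleftrightarrow>
     open U \<and> smooth_on U \<phi> \<and>
     (\<forall>a\<in>U. inj (frechet_derivative \<phi> (at a))) \<and>
     openin (top_of_set S) (\<phi> ` (U \<inter> half_plane)) \<and>
     (\<exists>\<psi>. homeomorphism (U \<inter> half_plane) (\<phi> ` (U \<inter> half_plane)) \<phi> \<psi>)"

definition surface_with_boundary :: "'a::euclidean_space set \<Rightarrow> bool" where
  "surface_with_boundary S \<longleftrightarrow>
     (\<forall>p\<in>S. \<exists>U \<phi>. local_parametrization S U \<phi> \<and> p \<in> \<phi> ` (U \<inter> half_plane))"

definition surface_boundary :: "'a::euclidean_space set \<Rightarrow> 'a set" where
  "surface_boundary S =
     {\<phi> a | U \<phi> a. local_parametrization S U \<phi> \<and> a \<in> U \<and> snd a = 0}"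

definition tangent_plane :: "'a::euclidean_space set \<Rightarrow> 'a \<Rightarrow> 'a set" where
  "tangent_plane S p =
     {frechet_derivative \<phi> (at a) v | U \<phi> a v.
        local_parametrization S U \<phi> \<and> a \<in> U \<inter> half_plane \<and> \<phi> a = p}"

section \<open>Extrinsic geometry in a Euclidean space with a Riemannian metric\<close>

text \<open>A metric on a Euclidean space assigns to every point \<open>p\<close> the bilinear form \<open>g p\<close>.
  In the global chart the Levi-Civita connection is
  \<open>\<nabla>\<^sub>X Y = DY(X) + \<Gamma>(X, Y)\<close> for a field \<open>\<Gamma>\<close> of bilinear maps (the Christoffel
  symbols). Symmetry of \<open>\<Gamma>\<close> is vanishing of the torsion; the last conjunct is
  compatibility with the metric, tested on constant vector fields.\<close>

definition levi_civita :: "('a::euclidean_space \<Rightarrow> 'a \<Rightarrow> 'a \<Rightarrow> real) \<Rightarrow> 'a \<Rightarrow> 'a \<Rightarrow> 'a \<Rightarrow> 'a" where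
  "levi_civita g p =
     (THE \<Gamma>. bilinear \<Gamma> \<and> (\<forall>v w. \<Gamma> v w = \<Gamma> w v) \<and>
        (\<forall>v w z. frechet_derivative (\<lambda>x. g x v w) (at p) z = g p (\<Gamma> z v) w + g p v (\<Gamma> z w)))"

text \<open>For a field \<open>Y\<close> along \<open>S\<close>, differentiable within \<open>S\<close>, the derivative within \<open>S\<close> is
  unique on vectors tangent to \<open>S\<close>, and only these are used for \<open>X\<close>.\<close>

definition covariant_derivative ::
  "('a::euclidean_space \<Rightarrow> 'a \<Rightarrow> 'a \<Rightarrow> real) \<Rightarrow> 'a set \<Rightarrow> ('a \<Rightarrow> 'a) \<Rightarrow> 'a \<Rightarrow> 'a \<Rightarrow> 'a" where
  "covariant_derivative g S Y p X =
     frechet_derivative Y (at p within S) X + levi_civita g p X (Y p)"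

definition unit_normal_field ::
  "('a::euclidean_space \<Rightarrow> 'a \<Rightarrow> 'a \<Rightarrow> real) \<Rightarrow> 'a set \<Rightarrow> ('a \<Rightarrow> 'a) \<Rightarrow> bool" where
  "unit_normal_field g S N \<longleftrightarrow>
     smooth_along S N \<and>
     (\<forall>p\<in>S. g p (N p) (N p) = 1 \<and> (\<forall>X\<in>tangent_plane S p. g p (N p) X = 0))"

definition shape_operator ::
  "('a::euclidean_space \<Rightarrow> 'a \<Rightarrow> 'a \<Rightarrow> real) \<Rightarrow> 'a set \<Rightarrow> ('a \<Rightarrow> 'a) \<Rightarrow> 'a \<Rightarrow> 'a \<Rightarrow> 'a" where
  "shape_operator g S N p X = - covariant_derivative g S N p X"

text \<open>Trace of an endomorphism \<open>T\<close> of the finite-dimensional subspace \<open>V\<close>, as the sum of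
  the diagonal entries of its matrix in some basis of \<open>V\<close>.\<close>

definition trace_on :: "'a::euclidean_space set \<Rightarrow> ('a \<Rightarrow> 'a) \<Rightarrow> real" where
  "trace_on V T =
     (let B = (SOME B. independent B \<and> span B = V) in \<Sum>b\<in>B. representation B (T b) b)"

definition mean_curvature ::
  "('a::euclidean_space \<Rightarrow> 'a \<Rightarrow> 'a \<Rightarrow> real) \<Rightarrow> 'a set \<Rightarrow> ('a \<Rightarrow> 'a) \<Rightarrow> 'a \<Rightarrow> real" where
  "mean_curvature g S N p = trace_on (tangent_plane S p) (shape_operator g S N p) / 2"

section \<open>The warped product and graphs\<close>

text \<open>Points are \<open>(t, q)\<close> with \<open>q = (x, y)\<close>; the metric is \<open>dt\<^sup>2 + e\<^bsup>2f(t)\<^esup>(dx\<^sup>2 + dy\<^sup>2)\<close>.\<close>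

type_synonym point = "real \<times> real \<times> real"

definition warped_metric :: "(real \<Rightarrow> real) \<Rightarrow> point \<Rightarrow> point \<Rightarrow> point \<Rightarrow> real" where
  "warped_metric f p v w = fst v * fst w + exp (2 * f (fst p)) * (snd v \<bullet> snd w)"

definition height :: "point \<Rightarrow> real" where
  "height p = fst p"

text \<open>Compact domains are closures of bounded domains (nonempty connected open sets);
  the last conjunct excludes slits and punctures inside the closure.\<close>

definition compact_domain :: "(real \<times> real) set \<Rightarrow> bool" where
  "compact_domain D \<longleftrightarrow>
     compact D \<and> interior D \<noteq> {} \<and> connected (interior D) \<and> closure (interior D) = D"

text \<open>The function is smooth in the interior of the domain; at the boundary only the
  surface is required to be smooth, so that it may have vertical tangent planes there (as
  a hemisphere has).\<close>

definition compact_graph :: "(real \<times> real) set \<Rightarrow> (real \<times> real \<Rightarrow> real) \<Rightarrow> point set \<Rightarrow> bool" where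
  "compact_graph D u S \<longleftrightarrow>
     compact_domain D \<and> continuous_on D u \<and> smooth_on (interior D) u \<and>
     S = (\<lambda>q. (u q, q)) ` D \<and> surface_with_boundary S"

section \<open>The Levi-Civita connection of the warped product\<close>

lemma frechet_derivative_warped_metric:
  assumes "f differentiable at (fst p)"
  shows "frechet_derivative (\<lambda>x. warped_metric f x v w) (at p) z =
    2 * deriv f (fst p) * exp (2 * f (fst p)) * fst z * (snd v \<bullet> snd w)"
proof -
  have "(f has_field_derivative deriv f (fst p)) (at (fst p))"
    using assms by (metis DERIV_deriv_iff_real_differentiable)
  then have "((\<lambda>x. exp (2 * f x)) has_field_derivative
      2 * deriv f (fst p) * exp (2 * f (fst p))) (at (fst p))"
    by (auto intro!: derivative_eq_intros)
  then have "((\<lambda>x. exp (2 * f x)) has_derivative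
      (\<lambda>s. 2 * deriv f (fst p) * exp (2 * f (fst p)) * s)) (at (fst p))"
    by (simp add: has_field_derivative_def)
  from has_derivative_compose[OF has_derivative_fst[OF has_derivative_ident] this]
  have "((\<lambda>x. exp (2 * f (fst x))) has_derivative
      (\<lambda>z. 2 * deriv f (fst p) * exp (2 * f (fst p)) * fst z)) (at p)"
    by simp
  from has_derivative_add[OF has_derivative_const has_derivative_mult_left[OF this]]
  have "((\<lambda>x. warped_metric f x v w) has_derivative
      (\<lambda>z. 2 * deriv f (fst p) * exp (2 * f (fst p)) * fst z * (snd v \<bullet> snd w))) (at p)"
    unfolding warped_metric_def by simp
  from frechet_derivative_at[OF this] show ?thesis
    by metis
qed

lemma levi_civita_warped_metric:
  assumes "f differentiable at (fst p)"
  shows "levi_civita (warped_metric f) p =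
    (\<lambda>v w. (- deriv f (fst p) * exp (2 * f (fst p)) * (snd v \<bullet> snd w),
            deriv f (fst p) *\<^sub>R (fst v *\<^sub>R snd w + fst w *\<^sub>R snd v)))"
    (is "_ = ?G")
proof -
  let ?g = "warped_metric f p"
  have sym: "?g v w = ?g w v" for v w
    by (simp add: warped_metric_def inner_commute)
  have nondeg: "v = w" if "\<And>z. ?g v z = ?g w z" for v w
  proof -
    have "?g v (v - w) - ?g w (v - w) = 0"
      using that by simp
    then have *: "(fst v - fst w)\<^sup>2 + exp (2 * f (fst p)) * ((snd v - snd w) \<bullet> (snd v - snd w)) = 0"
      by (simp add: warped_metric_def algebra_simps power2_eq_square inner_commute)
    have "exp (2 * f (fst p)) * ((snd v - snd w) \<bullet> (snd v - snd w)) \<ge> 0"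
      by simp
    with * have "(fst v - fst w)\<^sup>2 = 0" "exp (2 * f (fst p)) * ((snd v - snd w) \<bullet> (snd v - snd w)) = 0"
      using zero_le_power2[of "fst v - fst w"] by linarith+
    then show ?thesis
      by (simp add: prod_eq_iff)
  qed
  have bil: "bilinear ?G"
    unfolding bilinear_def
    by (auto intro!: linearI simp: algebra_simps scaleR_add_right inner_add_left inner_add_right)
  have comp: "frechet_derivative (\<lambda>x. warped_metric f x v w) (at p) z = ?g (?G z v) w + ?g v (?G z w)"
    for v w z
    unfolding frechet_derivative_warped_metric[OF assms]
    by (simp add: warped_metric_def algebra_simps inner_add_left inner_add_right inner_commute)
  show ?thesis
    unfolding levi_civita_def
  proof (rule the_equality, intro conjI allI)
    show "?G v w = ?G w v" for v w
      by (simp add: inner_commute add.commute)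
  next
    fix \<Gamma> :: "point \<Rightarrow> point \<Rightarrow> point"
    assume A: "bilinear \<Gamma> \<and> (\<forall>v w. \<Gamma> v w = \<Gamma> w v) \<and>
      (\<forall>v w z. frechet_derivative (\<lambda>x. warped_metric f x v w) (at p) z = ?g (\<Gamma> z v) w + ?g v (\<Gamma> z w))"
    have S1: "\<Gamma> v w = \<Gamma> w v" and S2: "?G v w = ?G w v" for v w
      using A by (blast, simp add: inner_commute add.commute)
    have C: "?g (\<Gamma> z v) w + ?g v (\<Gamma> z w) = ?g (?G z v) w + ?g v (?G z w)" for v w z
      using A comp by metis
    have "?g (\<Gamma> v w) z = ?g (?G v w) z" for v w z
      using C[of v w z] C[of w v z] C[of z v w] S1[of v w] S1[of v z] S1[of w z]
        S2[of v w] S2[of v z] S2[of w z]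
        sym[of v "\<Gamma> w z"] sym[of w "\<Gamma> v z"] sym[of v "?G w z"] sym[of w "?G v z"]
      by (smt (verit, ccfv_threshold))
    then show "\<Gamma> = ?G"
      by (intro ext nondeg)
  qed (use bil comp in auto)
qed

end

theory Submission
  imports Defs
begin

text \<open>In the graph coordinates \<open>q = (x, y)\<close> put \<open>\<theta> = \<langle>N, \<partial>\<^sub>t\<rangle>\<close> and let \<open>m\<close> be \<open>e\<^sup>f\<close> times the horizontal
  part of \<open>N\<close>. Then \<open>\<theta>\<^sup>2 + \<bar>m\<bar>\<^sup>2 = 1\<close>, \<open>\<theta> \<nabla>u = - e\<^sup>f m\<close>, and the mean curvature equation becomes
  \<open>div m = - 2 e\<^sup>f (H + f' \<theta>)\<close>. Over the interior of the domain \<open>\<theta>\<close> has no zeros, hence a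
  constant sign, and by invariance of domain \<open>u\<close> vanishes over the frontier.

  If \<open>\<theta> < 0\<close>, then for \<open>0 < c < H\<close> the function \<open>\<phi> = c h + e\<^sup>f \<theta>\<close> is strictly subharmonic at its
  critical points: this uses \<open>f \<ge> 0\<close>, \<open>f' \<le> 0\<close>, \<open>f'' \<ge> 0\<close> and \<open>\<bar>S\<bar>\<^sup>2 \<ge> 2 H\<^sup>2\<close>. So \<open>\<phi>\<close> attains its maximum
  over the frontier, where it is \<open>\<le> 0\<close>, whence \<open>c h \<le> - e\<^bsup>f(h)\<^esup> \<theta> \<le> e\<^bsup>f(0)\<^esup>\<close> where \<open>h > 0\<close>. If \<open>\<theta> > 0\<close>,
  then comparison with the slice at the highest point gives \<open>H \<le> - f'(h)\<close> there, and convexity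
  of \<open>f\<close> gives \<open>h H \<le> f(0) - f(h) \<le> e\<^bsup>f(0)\<^esup>\<close>.\<close>

section \<open>Calculus of directional derivatives\<close>

text \<open>The direction comes first so that \<open>dir_deriv v F\<close> is again a function of
  the point: derivatives can be iterated, in step with the recursion of
  \<open>Ck_on\<close>.\<close>

definition dir_deriv :: "'a::euclidean_space \<Rightarrow> ('a \<Rightarrow> 'b::real_normed_vector) \<Rightarrow> 'a \<Rightarrow> 'b" where
  "dir_deriv v F = (\<lambda>x. frechet_derivative F (at x) v)"

lemma Ck_on_Suc:
  "Ck_on (Suc k) U F \<longleftrightarrow> (\<forall>x\<in>U. F differentiable at x) \<and> (\<forall>v. Ck_on k U (dir_deriv v F))"
  by (simp add: dir_deriv_def)

lemma dir_deriv_eqI: "(F has_derivative F') (at x) \<Longrightarrow> dir_deriv v F x = F' v"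
  unfolding dir_deriv_def using frechet_derivative_at by metis

section \<open>Locality and closure properties of the classes \<open>Ck_on\<close>\<close>

lemma dir_deriv_cong_open:
  assumes "open U" "x \<in> U" "\<And>y. y \<in> U \<Longrightarrow> F y = G y"
  shows "dir_deriv v F x = dir_deriv v G x"
proof -
  have "(F has_derivative F') (at x) \<longleftrightarrow> (G has_derivative F') (at x)" for F'
    using has_derivative_transform_within_open[of F F' x UNIV U G]
      has_derivative_transform_within_open[of G F' x UNIV U F] assms by auto
  then show ?thesis
    by (simp add: dir_deriv_def frechet_derivative_def)
qed

text \<open>Derivatives at a point of an open set depend only on nearby values. This allows a
  derivative to be replaced by an explicit formula that is valid on \<open>U\<close> only.\<close>

lemma Ck_on_cong:
  assumes "open U" "\<And>x. x \<in> U \<Longrightarrow> F x = G x"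
  shows "Ck_on k U F \<longleftrightarrow> Ck_on k U G"
proof -
  have imp: "Ck_on k U G" if "Ck_on k U F" "\<And>x. x \<in> U \<Longrightarrow> F x = G x" for F G :: "'a \<Rightarrow> 'b"
    using that
  proof (induction k arbitrary: F G)
    case 0
    then show ?case by (simp cong: continuous_on_cong)
  next
    case (Suc k)
    have "G differentiable at x" if x: "x \<in> U" for x
    proof -
      obtain F' where "(F has_derivative F') (at x)"
        using Suc.prems x by (auto simp: differentiable_def)
      then have "(G has_derivative F') (at x)"
        using has_derivative_transform_within_open[of F F' x UNIV U G] assms(1) x Suc.prems(2) by auto
      then show ?thesis by (auto simp: differentiable_def)
    qed
    moreover have "Ck_on k U (dir_deriv v G)" for v
      using Suc.IH[of "dir_deriv v F" "dir_deriv v G"] Suc.prems dir_deriv_cong_open[OF assms(1), of _ F G]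
      unfolding Ck_on_Suc by metis
    ultimately show ?case unfolding Ck_on_Suc by blast
  qed
  show ?thesis using imp[of F G] imp[of G F] assms(2) by metis
qed

lemma Ck_on_SucD: "Ck_on (Suc k) U F \<Longrightarrow> Ck_on k U F"
proof (induction k arbitrary: F)
  case 0
  then show ?case
    by (auto intro!: continuous_at_imp_continuous_on differentiable_imp_continuous_within)
next
  case (Suc k)
  then show ?case unfolding Ck_on_Suc[of "Suc k"] Ck_on_Suc[of k] by blast
qed

lemma Ck_on_le: "Ck_on k U F \<Longrightarrow> j \<le> k \<Longrightarrow> Ck_on j U F"
  by (induction k) (auto simp: le_Suc_eq simp del: Ck_on.simps dest: Ck_on_SucD)

lemma Ck_on_imp_continuous_on: "Ck_on k U F \<Longrightarrow> continuous_on U F"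
  using Ck_on_le[of k U F 0] by simp

lemma Ck_on_const: "Ck_on k U (\<lambda>x. c)"
proof (induction k arbitrary: c)
  case (Suc k)
  have "dir_deriv v (\<lambda>x. c) = (\<lambda>x::'a. 0::'b)" for v
    by (auto simp: dir_deriv_def frechet_derivative_const)
  then show ?case unfolding Ck_on_Suc using Suc by simp
qed simp

lemma Ck_on_bounded_linear:
  assumes "open U" "bounded_linear L" "Ck_on k U F"
  shows "Ck_on k U (\<lambda>x. L (F x))"
  using assms(3)
proof (induction k arbitrary: F)
  case 0
  then show ?case
    using bounded_linear.continuous_on[OF assms(2)] by simp
next
  case (Suc k)
  have D: "((\<lambda>x. L (F x)) has_derivative (\<lambda>v. L (frechet_derivative F (at x) v))) (at x)" if "x \<in> U" for x
    using Suc.prems that by (intro bounded_linear.has_derivative[OF assms(2)])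
      (simp add: frechet_derivative_works)
  moreover have "Ck_on k U (dir_deriv v (\<lambda>x. L (F x)))" for v
  proof -
    have "Ck_on k U (\<lambda>x. L (dir_deriv v F x))"
      using Suc unfolding Ck_on_Suc by blast
    then show ?thesis
      using Ck_on_cong[OF assms(1), of "dir_deriv v (\<lambda>x. L (F x))" "\<lambda>x. L (dir_deriv v F x)"]
        dir_deriv_eqI[OF D] by (simp add: dir_deriv_def)
  qed
  ultimately show ?case unfolding Ck_on_Suc by (auto simp: differentiable_def)
qed

lemma Ck_on_add:
  assumes "open U" "Ck_on k U F" "Ck_on k U G"
  shows "Ck_on k U (\<lambda>x. F x + G x)"
  using assms(2,3)
proof (induction k arbitrary: F G)
  case 0
  then show ?case by (simp add: continuous_on_add)
next
  case (Suc k)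
  have D: "((\<lambda>x. F x + G x) has_derivative
      (\<lambda>v. frechet_derivative F (at x) v + frechet_derivative G (at x) v)) (at x)" if "x \<in> U" for x
    using Suc.prems that has_derivative_add by (simp add: frechet_derivative_works)
  moreover have "Ck_on k U (dir_deriv v (\<lambda>x. F x + G x))" for v
  proof -
    have "Ck_on k U (\<lambda>x. dir_deriv v F x + dir_deriv v G x)"
      using Suc unfolding Ck_on_Suc by blast
    then show ?thesis
      using Ck_on_cong[OF assms(1), of "dir_deriv v (\<lambda>x. F x + G x)" "\<lambda>x. dir_deriv v F x + dir_deriv v G x"]
        dir_deriv_eqI[OF D] by (simp add: dir_deriv_def)
  qed
  ultimately show ?case unfolding Ck_on_Suc by (auto simp: differentiable_def)
qed

lemma Ck_on_scaleR:
  fixes F :: "'a::euclidean_space \<Rightarrow> real"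
  assumes "open U" "Ck_on k U F" "Ck_on k U G"
  shows "Ck_on k U (\<lambda>x. F x *\<^sub>R G x)"
  using assms(2,3)
proof (induction k arbitrary: F G)
  case 0
  then show ?case by (simp add: continuous_on_scaleR)
next
  case (Suc k)
  have D: "((\<lambda>x. F x *\<^sub>R G x) has_derivative
      (\<lambda>v. F x *\<^sub>R frechet_derivative G (at x) v + frechet_derivative F (at x) v *\<^sub>R G x)) (at x)"
    if "x \<in> U" for x
    using Suc.prems that by (intro has_derivative_scaleR) (auto simp: frechet_derivative_works[symmetric])
  moreover have "Ck_on k U (dir_deriv v (\<lambda>x. F x *\<^sub>R G x))" for v
  proof -
    have "Ck_on k U (\<lambda>x. F x *\<^sub>R dir_deriv v G x + dir_deriv v F x *\<^sub>R G x)"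
      using Suc.IH Suc.prems Ck_on_SucD[OF Suc.prems(1)] Ck_on_SucD[OF Suc.prems(2)]
      by (intro Ck_on_add[OF assms(1)]) (auto simp: Ck_on_Suc simp del: Ck_on.simps)
    then show ?thesis
      using Ck_on_cong[OF assms(1), of "dir_deriv v (\<lambda>x. F x *\<^sub>R G x)"
          "\<lambda>x. F x *\<^sub>R dir_deriv v G x + dir_deriv v F x *\<^sub>R G x"]
        dir_deriv_eqI[OF D] by (simp add: dir_deriv_def)
  qed
  ultimately show ?case unfolding Ck_on_Suc by (auto simp: differentiable_def)
qed

lemma Ck_on_sum:
  assumes "open U" "\<And>i. i \<in> I \<Longrightarrow> Ck_on k U (F i)"
  shows "Ck_on k U (\<lambda>x. \<Sum>i\<in>I. F i x)"
  using assms(2)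
  by (induction I rule: infinite_finite_induct) (auto intro: Ck_on_const Ck_on_add[OF assms(1)])

lemma Ck_on_Pair:
  assumes "open U" "Ck_on k U F" "Ck_on k U G"
  shows "Ck_on k U (\<lambda>x. (F x, G x))"
proof -
  have "bounded_linear (\<lambda>x::'b. (x, 0::'c))" "bounded_linear (\<lambda>x::'c. (0::'b, x))"
    by (auto intro!: bounded_linear_Pair bounded_linear_ident bounded_linear_zero)
  then have "Ck_on k U (\<lambda>x. (F x, 0::'c) + (0::'b, G x))"
    using assms by (intro Ck_on_add Ck_on_bounded_linear[of U "\<lambda>x::'b. (x, 0::'c)"]
        Ck_on_bounded_linear[of U "\<lambda>x::'c. (0::'b, x)"]) auto
  then show ?thesis by simp
qed

lemma Ck_on_ident: "Ck_on k U (\<lambda>x. x)"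
proof (cases k)
  case (Suc j)
  have "dir_deriv v (\<lambda>x::'a. x) = (\<lambda>x. v)" for v
    by (auto simp: dir_deriv_def)
  then show ?thesis unfolding Suc Ck_on_Suc by (simp add: Ck_on_const)
qed simp

text \<open>The chain rule is expanded in the standard basis: a directional derivative of the
  composition is a sum of components of the derivative of \<open>F\<close> times some
  \<open>dir_deriv b G\<close> composed with \<open>F\<close>. The induction hypothesis is applied
  to these compositions, so \<open>G\<close> varies in the induction while \<open>F\<close> is
  fixed.\<close>

lemma Ck_on_compose:
  fixes F :: "'a::euclidean_space \<Rightarrow> 'b::euclidean_space" and G :: "'b \<Rightarrow> 'c::real_normed_vector"
  assumes "open U" "open W" "F ` U \<subseteq> W" "Ck_on k U F" "Ck_on k W G"
  shows "Ck_on k U (\<lambda>x. G (F x))"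
  using assms(4,5)
proof (induction k arbitrary: G)
  case 0
  then show ?case using assms(3) by (auto intro: continuous_on_compose2)
next
  case (Suc k)
  have D: "((\<lambda>x. G (F x)) has_derivative
      (\<lambda>v. frechet_derivative G (at (F x)) (frechet_derivative F (at x) v))) (at x)" if "x \<in> U" for x
  proof -
    have "F differentiable at x" "G differentiable at (F x)"
      using Suc.prems that assms(3) by auto
    then show ?thesis
      using has_derivative_compose unfolding frechet_derivative_works by blast
  qed
  moreover have "Ck_on k U (dir_deriv v (\<lambda>x. G (F x)))" for v
  proof -
    have eq: "dir_deriv v (\<lambda>x. G (F x)) x
        = (\<Sum>b\<in>Basis. (dir_deriv v F x \<bullet> b) *\<^sub>R dir_deriv b G (F x))" if "x \<in> U" for x
    proof -
      have lin: "linear (frechet_derivative G (at (F x)))"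
        using Suc.prems(2) assms(3) that by (intro linear_frechet_derivative) auto
      have "dir_deriv v (\<lambda>x. G (F x)) x = frechet_derivative G (at (F x)) (dir_deriv v F x)"
        using dir_deriv_eqI[OF D[OF that]] by (simp add: dir_deriv_def)
      also have "\<dots> = frechet_derivative G (at (F x)) (\<Sum>b\<in>Basis. (dir_deriv v F x \<bullet> b) *\<^sub>R b)"
        by (simp add: euclidean_representation)
      also have "\<dots> = (\<Sum>b\<in>Basis. (dir_deriv v F x \<bullet> b) *\<^sub>R dir_deriv b G (F x))"
        by (simp add: linear_sum[OF lin] linear_scale[OF lin] dir_deriv_def)
      finally show ?thesis .
    qed
    have "Ck_on k U (\<lambda>x. \<Sum>b\<in>Basis. (dir_deriv v F x \<bullet> b) *\<^sub>R dir_deriv b G (F x))"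
      using Suc.prems(1,2) Suc.IH[OF Ck_on_SucD[OF Suc.prems(1)]]
      by (intro Ck_on_sum Ck_on_scaleR assms(1) Ck_on_bounded_linear[OF _ bounded_linear_inner_left])
        (auto simp: Ck_on_Suc simp del: Ck_on.simps)
    then show ?thesis
      using Ck_on_cong[OF assms(1), of "dir_deriv v (\<lambda>x. G (F x))"
          "\<lambda>x. \<Sum>b\<in>Basis. (dir_deriv v F x \<bullet> b) *\<^sub>R dir_deriv b G (F x)"] eq
      by blast
  qed
  ultimately show ?case unfolding Ck_on_Suc by (auto simp: differentiable_def)
qed

section \<open>Restriction to lines and symmetry of second derivatives\<close>

lemma has_real_derivative_line:
  fixes F :: "'a::euclidean_space \<Rightarrow> real"
  assumes "F differentiable at (x + s *\<^sub>R v)"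
  shows "((\<lambda>s. F (x + s *\<^sub>R v)) has_real_derivative dir_deriv v F (x + s *\<^sub>R v)) (at s)"
proof -
  have "((\<lambda>s. x + s *\<^sub>R v) has_derivative (\<lambda>h. h *\<^sub>R v)) (at s)"
    by (auto intro!: derivative_eq_intros)
  from has_derivative_compose[OF this assms[unfolded frechet_derivative_works]]
  show ?thesis
    using linear_frechet_derivative[OF assms]
    by (simp add: has_field_derivative_def dir_deriv_def linear_scale mult_commute_abs)
qed

lemma dir_deriv_eq_line:
  fixes F :: "'a::euclidean_space \<Rightarrow> real"
  assumes "F differentiable at x" "((\<lambda>s. F (x + s *\<^sub>R v)) has_real_derivative d) (at 0)"
  shows "dir_deriv v F x = d"
  using has_real_derivative_line[of F x 0 v] assms DERIV_unique by fastforce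

text \<open>Two applications of the mean value theorem: in direction \<open>v\<close> to the first
  difference in direction \<open>w\<close>, then in direction \<open>w\<close> to
  \<open>dir_deriv v F\<close>. The second difference on the left is symmetric in \<open>v\<close>
  and \<open>w\<close>.\<close>

lemma second_difference_mvt:
  fixes F :: "'a::euclidean_space \<Rightarrow> real"
  assumes C: "Ck_on 2 U F" and h: "0 < h"
    and sub: "\<And>s t. \<lbrakk>0 \<le> s; s \<le> h; 0 \<le> t; t \<le> h\<rbrakk> \<Longrightarrow> x + s *\<^sub>R v + t *\<^sub>R w \<in> U"
  obtains s t where "0 < s" "s < h" "0 < t" "t < h"
    "F (x + h *\<^sub>R v + h *\<^sub>R w) - F (x + h *\<^sub>R v) - F (x + h *\<^sub>R w) + F x
      = h * h * dir_deriv w (dir_deriv v F) (x + s *\<^sub>R v + t *\<^sub>R w)"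
proof -
  have C1: "\<And>x. x \<in> U \<Longrightarrow> F differentiable at x"
    and C2: "\<And>x. x \<in> U \<Longrightarrow> dir_deriv v F differentiable at x"
    using C unfolding numeral_2_eq_2 Ck_on_Suc by blast+
  define g where "g s = F (x + h *\<^sub>R w + s *\<^sub>R v) - F (x + s *\<^sub>R v)" for s
  have "\<exists>s>0. s < h \<and> g h - g 0 =
     (h - 0) * (dir_deriv v F (x + h *\<^sub>R w + s *\<^sub>R v) - dir_deriv v F (x + s *\<^sub>R v))"
    unfolding g_def
  proof (rule MVT2[OF h], rule DERIV_diff)
    fix s assume "0 \<le> s" "s \<le> h"
    then have "x + h *\<^sub>R w + s *\<^sub>R v \<in> U" "x + s *\<^sub>R v \<in> U"
      using sub[of s h] sub[of s 0] h by (auto simp: algebra_simps)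
    then show "((\<lambda>s. F (x + h *\<^sub>R w + s *\<^sub>R v)) has_real_derivative dir_deriv v F (x + h *\<^sub>R w + s *\<^sub>R v)) (at s)"
      "((\<lambda>s. F (x + s *\<^sub>R v)) has_real_derivative dir_deriv v F (x + s *\<^sub>R v)) (at s)"
      using C1 by (auto intro: has_real_derivative_line)
  qed
  then obtain s where s: "0 < s" "s < h" and
    1: "g h - g 0 = h * (dir_deriv v F (x + h *\<^sub>R w + s *\<^sub>R v) - dir_deriv v F (x + s *\<^sub>R v))"
    by auto
  have "\<exists>t>0. t < h \<and> dir_deriv v F (x + s *\<^sub>R v + h *\<^sub>R w) - dir_deriv v F (x + s *\<^sub>R v + 0 *\<^sub>R w) =
     (h - 0) * dir_deriv w (dir_deriv v F) (x + s *\<^sub>R v + t *\<^sub>R w)"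
    using s sub C2 by (intro MVT2[OF h] has_real_derivative_line) auto
  then obtain t where t: "0 < t" "t < h" and
    2: "dir_deriv v F (x + s *\<^sub>R v + h *\<^sub>R w) - dir_deriv v F (x + s *\<^sub>R v) =
     h * dir_deriv w (dir_deriv v F) (x + s *\<^sub>R v + t *\<^sub>R w)"
    by auto
  have "F (x + h *\<^sub>R v + h *\<^sub>R w) - F (x + h *\<^sub>R v) - F (x + h *\<^sub>R w) + F x = g h - g 0"
    by (simp add: g_def algebra_simps)
  also have "\<dots> = h * h * dir_deriv w (dir_deriv v F) (x + s *\<^sub>R v + t *\<^sub>R w)"
    using 1 2 by (simp add: algebra_simps)
  finally show thesis using that s t by blast
qed

text \<open>Schwarz's theorem: the symmetric second difference forces the two mixed derivatives to
  take a common value at two points close to \<open>x\<close>, and continuity of both carries the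
  equality to \<open>x\<close>.\<close>

lemma dir_deriv_commute:
  fixes F :: "'a::euclidean_space \<Rightarrow> real"
  assumes U: "open U" and x: "x \<in> U" and C: "Ck_on 2 U F"
  shows "dir_deriv v (dir_deriv w F) x = dir_deriv w (dir_deriv v F) x"
proof -
  have cont: "continuous_on U (dir_deriv a (dir_deriv b F))" for a b
    using C unfolding numeral_2_eq_2 Ck_on_Suc by simp
  have near: "\<exists>d>0. \<forall>y. dist y x < d \<longrightarrow> y \<in> U \<and> \<bar>dir_deriv a (dir_deriv b F) y - dir_deriv a (dir_deriv b F) x\<bar> < e"
    if "e > 0" for a b e
  proof -
    obtain d1 where d1: "d1 > 0" "\<And>y. dist y x < d1 \<Longrightarrow> y \<in> U"
      using U x unfolding open_dist by blast
    have "isCont (dir_deriv a (dir_deriv b F)) x"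
      using cont U x continuous_on_eq_continuous_at by blast
    then obtain d2 where d2: "d2 > 0"
      "\<And>y. dist y x < d2 \<Longrightarrow> \<bar>dir_deriv a (dir_deriv b F) y - dir_deriv a (dir_deriv b F) x\<bar> < e"
      using \<open>e > 0\<close> unfolding continuous_at_eps_delta dist_real_def by metis
    show ?thesis using d1 d2 by (intro exI[of _ "min d1 d2"]) auto
  qed
  have "\<bar>dir_deriv v (dir_deriv w F) x - dir_deriv w (dir_deriv v F) x\<bar> \<le> 2 * e" if e: "e > 0" for e
  proof -
    obtain d1 where d1: "d1 > 0" "\<And>y. dist y x < d1 \<Longrightarrow> y \<in> U \<and>
        \<bar>dir_deriv v (dir_deriv w F) y - dir_deriv v (dir_deriv w F) x\<bar> < e"
      using near[OF e] by blast
    obtain d2 where d2: "d2 > 0" "\<And>y. dist y x < d2 \<Longrightarrow>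
        \<bar>dir_deriv w (dir_deriv v F) y - dir_deriv w (dir_deriv v F) x\<bar> < e"
      using near[OF e] by blast
    \<comment> \<open>This size keeps the parallelogram with sides \<open>h\<close> times
      \<open>v\<close> and \<open>h\<close> times \<open>w\<close> within distance
      \<open>min d1 d2\<close> of \<open>x\<close>; the summand 1 covers the case of zero
      vectors.\<close>
    define h where "h = min d1 d2 / (2 * (norm v + norm w + 1))"
    have nn: "norm v + norm w + 1 > 0" by (simp add: add_nonneg_pos)
    have h: "h > 0" using d1 d2 nn by (simp add: h_def)
    have hs: "h * (norm v + norm w) < min d1 d2"
    proof -
      have "h * (norm v + norm w) < h * (2 * (norm v + norm w + 1))"
        using h by (intro mult_strict_left_mono) (auto simp: add_nonneg_pos)
      also have "\<dots> = min d1 d2" using nn by (simp add: h_def)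
      finally show ?thesis .
    qed
    have D: "dist (x + s *\<^sub>R v + t *\<^sub>R w) x < min d1 d2" if "0 \<le> s" "s \<le> h" "0 \<le> t" "t \<le> h" for s t
    proof -
      have "norm (s *\<^sub>R v + t *\<^sub>R w) \<le> s * norm v + t * norm w"
        using norm_triangle_ineq[of "s *\<^sub>R v" "t *\<^sub>R w"] that by simp
      also have "\<dots> \<le> h * (norm v + norm w)"
        using that by (simp add: distrib_left add_mono mult_right_mono)
      finally show ?thesis using hs by (simp add: dist_norm add.assoc)
    qed
    obtain s t where st: "0 < s" "s < h" "0 < t" "t < h"
      "F (x + h *\<^sub>R v + h *\<^sub>R w) - F (x + h *\<^sub>R v) - F (x + h *\<^sub>R w) + F x
      = h * h * dir_deriv w (dir_deriv v F) (x + s *\<^sub>R v + t *\<^sub>R w)"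
      using second_difference_mvt[OF C h, of x v w] D d1 by (metis min_less_iff_conj)
    have D': "dist (x + t *\<^sub>R w + s *\<^sub>R v) x < min d1 d2" if "0 \<le> s" "s \<le> h" "0 \<le> t" "t \<le> h" for s t
      using D[OF that] by (simp add: add.assoc add.commute[of "t *\<^sub>R w"])
    obtain s' t' where st': "0 < s'" "s' < h" "0 < t'" "t' < h"
      "F (x + h *\<^sub>R w + h *\<^sub>R v) - F (x + h *\<^sub>R w) - F (x + h *\<^sub>R v) + F x
      = h * h * dir_deriv v (dir_deriv w F) (x + s' *\<^sub>R w + t' *\<^sub>R v)"
      using second_difference_mvt[OF C h, of x w v] D' d1 by (metis min_less_iff_conj)
    have "h * h * dir_deriv w (dir_deriv v F) (x + s *\<^sub>R v + t *\<^sub>R w)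
        = h * h * dir_deriv v (dir_deriv w F) (x + s' *\<^sub>R w + t' *\<^sub>R v)"
      unfolding st(5)[symmetric] st'(5)[symmetric] by (simp add: algebra_simps)
    then have eq: "dir_deriv w (dir_deriv v F) (x + s *\<^sub>R v + t *\<^sub>R w)
        = dir_deriv v (dir_deriv w F) (x + s' *\<^sub>R w + t' *\<^sub>R v)"
      using h by simp
    show ?thesis
      using d1(2)[of "x + s' *\<^sub>R w + t' *\<^sub>R v"] d2(2)[of "x + s *\<^sub>R v + t *\<^sub>R w"]
        D[of s t] D'[of t' s'] st st' eq by auto
  qed
  then have "\<bar>dir_deriv v (dir_deriv w F) x - dir_deriv w (dir_deriv v F) x\<bar> \<le> 0"
    using field_le_epsilon[of "\<bar>dir_deriv v (dir_deriv w F) x - dir_deriv w (dir_deriv v F) x\<bar>" 0]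
    by (metis add_0 field_sum_of_halves half_gt_zero mult_2)
  then show ?thesis by simp
qed

section \<open>Necessary conditions at an interior maximum\<close>

lemma second_derivative_nonpos_at_max:
  fixes g :: "real \<Rightarrow> real"
  assumes e: "e > 0" and g: "\<And>s. \<bar>s\<bar> < e \<Longrightarrow> (g has_real_derivative g' s) (at s)"
    and g': "(g' has_real_derivative g'') (at 0)"
    and max: "\<And>s. \<bar>s\<bar> < e \<Longrightarrow> g s \<le> g 0"
  shows "g' 0 = 0" "g'' \<le> 0"
proof -
  show 0: "g' 0 = 0"
    using DERIV_local_max[OF g[of 0] e] e max by simp
  show "g'' \<le> 0"
  proof (rule ccontr)
    assume "\<not> g'' \<le> 0"
    then obtain d where d: "d > 0" "\<And>h. 0 < h \<Longrightarrow> h < d \<Longrightarrow> g' 0 < g' (0 + h)"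
      using DERIV_pos_inc_right[OF g'] by auto
    define b where "b = min d e / 2"
    have b: "0 < b" "b < d" "b < e" using d e by (auto simp: b_def)
    have "\<exists>z>0. z < b \<and> g b - g 0 = (b - 0) * g' z"
      using b by (intro MVT2 g) auto
    then obtain z where "0 < z" "z < b" "g b - g 0 = b * g' z" by auto
    moreover have "g' z > 0" using d(2)[of z] 0 b \<open>0 < z\<close> \<open>z < b\<close> by simp
    ultimately have "g b > g 0" using b by (metis diff_gt_0_iff_gt mult_pos_pos)
    then show False using max[of b] b by simp
  qed
qed

lemma dir_deriv_at_local_max:
  fixes F :: "'a::euclidean_space \<Rightarrow> real"
  assumes "open U" "x \<in> U" "Ck_on 2 U F" "\<And>y. y \<in> U \<Longrightarrow> F y \<le> F x"
  shows "dir_deriv v F x = 0" "dir_deriv v (dir_deriv v F) x \<le> 0"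
proof -
  have C1: "\<And>x. x \<in> U \<Longrightarrow> F differentiable at x"
    and C2: "\<And>x. x \<in> U \<Longrightarrow> dir_deriv v F differentiable at x"
    using assms(3) unfolding numeral_2_eq_2 Ck_on_Suc by blast+
  have "open ((\<lambda>s. x + s *\<^sub>R v) -` U)"
    by (intro open_vimage assms(1) continuous_intros)
  moreover have "0 \<in> (\<lambda>s. x + s *\<^sub>R v) -` U" using assms(2) by simp
  ultimately obtain e where "e > 0" "ball 0 e \<subseteq> (\<lambda>s. x + s *\<^sub>R v) -` U"
    by (meson open_contains_ball)
  then have e: "e > 0" "\<And>s. \<bar>s\<bar> < e \<Longrightarrow> x + s *\<^sub>R v \<in> U"
    by (auto simp: subset_iff dist_real_def)
  have D2: "((\<lambda>s. dir_deriv v F (x + s *\<^sub>R v)) has_real_derivative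
      dir_deriv v (dir_deriv v F) (x + 0 *\<^sub>R v)) (at 0)"
    using C2 assms(2) by (intro has_real_derivative_line) simp
  have D1: "((\<lambda>s. F (x + s *\<^sub>R v)) has_real_derivative dir_deriv v F (x + s *\<^sub>R v)) (at s)"
    if "\<bar>s\<bar> < e" for s
    using C1 e that by (intro has_real_derivative_line) simp
  have M: "F (x + s *\<^sub>R v) \<le> F (x + 0 *\<^sub>R v)" if "\<bar>s\<bar> < e" for s
    using assms(4) e that by simp
  show "dir_deriv v F x = 0" "dir_deriv v (dir_deriv v F) x \<le> 0"
    using second_derivative_nonpos_at_max[OF e(1) D1 D2 M] by simp_all
qed

section \<open>The mean curvature equation at a maximum\<close>

text \<open>Tool for differentiating an identity on \<open>U\<close>: once it is written as a
  vanishing \<open>\<Psi>\<close>, whatever expression \<open>d\<close> the derivative rules produce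
  along a line must be 0.\<close>

lemma dir_deriv_of_vanishing:
  fixes \<Psi> :: "'a::euclidean_space \<Rightarrow> real"
  assumes "open U" "x \<in> U" "\<And>y. y \<in> U \<Longrightarrow> \<Psi> y = 0"
    and "((\<lambda>s. \<Psi> (x + s *\<^sub>R v)) has_real_derivative d) (at 0)"
  shows "d = 0"
proof -
  have "open ((\<lambda>s. x + s *\<^sub>R v) -` U)"
    by (intro open_vimage assms(1) continuous_intros)
  then have "\<forall>\<^sub>F s in nhds 0. s \<in> (\<lambda>s. x + s *\<^sub>R v) -` U"
    using assms(2) by (intro eventually_nhds_in_open) auto
  then have "\<forall>\<^sub>F s in nhds 0. \<Psi> (x + s *\<^sub>R v) = 0"
    by (rule eventually_mono) (use assms(3) in auto)
  then have "((\<lambda>s. 0) has_real_derivative d) (at 0)"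
    using assms(4) DERIV_cong_ev[of 0 0 "\<lambda>s. \<Psi> (x + s *\<^sub>R v)" "\<lambda>s. 0" d d] by simp
  then show ?thesis using DERIV_unique DERIV_const by blast
qed

text \<open>All quantities are values at the maximum of \<open>\<phi>\<close>, in an orthonormal frame with \<open>m = (\<mu>, 0)\<close>;
  \<open>a\<close>, \<open>b\<close>, \<open>d\<close> are the entries of the derivative of \<open>m\<close>. The hypothesis \<open>hess\<close> is the second
  derivative of \<open>\<phi>\<close> traced with the inverse of the induced metric, which is \<open>diag(\<theta>\<^sup>2, 1)\<close> up to scaling.\<close>

lemma cmc_max_principle_algebra:
  fixes \<theta> \<mu> :: real
  assumes unit: "\<theta>\<^sup>2 + \<mu>\<^sup>2 = 1" and neg: "\<theta> < 0"
    and u1: "\<theta> * u1 = - E * \<mu>" and crit: "\<kappa> * u1 + E * \<theta>1 = 0"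
    and \<kappa>: "\<kappa> = c + E * f1 * \<theta>" and K: "K = E * (H + f1 * \<theta>)"
    and unit1: "\<theta> * \<theta>1 + \<mu> * a = 0" and unit2: "\<mu> * b = 0" and div: "a + d = - 2 * K"
    and unit11: "\<theta>1\<^sup>2 + \<theta> * \<theta>11 + a\<^sup>2 + b\<^sup>2 + \<mu> * \<mu>11 = 0"
    and unit22: "\<theta> * \<theta>22 + b\<^sup>2 + d\<^sup>2 + \<mu> * \<mu>22 = 0"
    and codazzi: "\<theta>22 * \<mu> - \<theta>1 * d = \<theta> * (\<mu>22 - w)"
    and div1: "\<mu>11 + w = - 2 * K1"
    and K1: "K1 = E * f1 * u1 * (H + f1 * \<theta>) + E * (f2 * u1 * \<theta> + f1 * \<theta>1)"
    and u11: "\<theta>1 * u1 + \<theta> * u11 = - E * f1 * u1 * \<mu> - E * a" and u22: "\<theta> * u22 = - E * d"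
    and hess: "\<theta>\<^sup>2 * (\<kappa> * u11 + E * \<theta> * (f1\<^sup>2 + f2) * u1\<^sup>2 + 2 * E * f1 * u1 * \<theta>1 + E * \<theta>11)
      + (\<kappa> * u22 + E * \<theta>22) \<le> 0"
    and E: "E \<ge> 1" and c: "0 < c" "c < H" and f: "f1 \<le> 0" "f2 \<ge> 0"
  shows False
proof -
  \<comment> \<open>The criticality equation is multiplied by \<open>\<theta>\<close> to eliminate
    \<open>u1\<close>; what remains is divisible by \<open>E\<close>.\<close>
  have \<theta>1: "\<theta> * \<theta>1 = \<kappa> * \<mu>"
  proof -
    have "E * (\<theta> * \<theta>1 - \<kappa> * \<mu>) = 0" using u1 crit by algebra
    then show ?thesis using E by simp
  qed
  \<comment> \<open>Source of the final case distinction: either \<open>\<mu> = 0\<close>, or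
    \<open>a\<close> is determined.\<close>
  have a\<mu>: "\<mu> * (a + \<kappa>) = 0" using \<theta>1 unit1 by algebra
  \<comment> \<open>This is the combination of second derivatives of \<open>m\<close> that enters
    \<open>Q\<close> below. The differentiated Codazzi, unit length and divergence relations reduce
    it to first derivatives.\<close>
  define T where "T = \<theta>\<^sup>2 * \<mu>11 + \<mu>22"
  have T: "T = - \<mu> * d\<^sup>2 - \<kappa> * \<mu> * d - 2 * \<theta>\<^sup>2 * K1"
  proof -
    have "\<theta>\<^sup>2 * \<mu>22 = \<mu> * (\<theta> * \<theta>22) - \<theta> * \<theta>1 * d + \<theta>\<^sup>2 * w"
      using codazzi by algebra
    also have "\<theta> * \<theta>22 = - (b\<^sup>2 + d\<^sup>2 + \<mu> * \<mu>22)" using unit22 by linarith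
    also have "w = - 2 * K1 - \<mu>11" using div1 by linarith
    finally have "\<theta>\<^sup>2 * \<mu>22 = - \<mu> * b\<^sup>2 - \<mu> * d\<^sup>2 - \<mu>\<^sup>2 * \<mu>22 - \<kappa> * \<mu> * d - 2 * \<theta>\<^sup>2 * K1 - \<theta>\<^sup>2 * \<mu>11"
      unfolding \<theta>1 by (simp add: algebra_simps power2_eq_square)
    moreover have "\<mu> * b\<^sup>2 = 0" using unit2 by (simp add: power2_eq_square)
    moreover have "\<mu>22 = \<theta>\<^sup>2 * \<mu>22 + \<mu>\<^sup>2 * \<mu>22" using unit by algebra
    ultimately show ?thesis unfolding T_def by linarith
  qed
  define g where "g = E * f1"
  have \<theta>K1: "\<theta> * K1 = \<mu> * (- g * E * H - g\<^sup>2 * \<theta> - E\<^sup>2 * f2 * \<theta> + g * \<kappa>)"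
    unfolding K1 g_def using u1 \<theta>1 by algebra
  have Q: "\<theta> * (\<theta>\<^sup>2 * \<theta>11 + \<theta>22) = - a\<^sup>2 - d\<^sup>2 - 2 * b\<^sup>2 + \<mu>\<^sup>2 * d * (d + \<kappa>) + 2 * \<mu> * \<theta> * (\<theta> * K1)"
  proof -
    have "\<theta> * (\<theta>\<^sup>2 * \<theta>11 + \<theta>22) = - (\<theta> * \<theta>1)\<^sup>2 - \<theta>\<^sup>2 * a\<^sup>2 - \<theta>\<^sup>2 * b\<^sup>2 - b\<^sup>2 - d\<^sup>2 - \<mu> * T"
      unfolding T_def using unit11 unit22 by algebra
    also have "(\<theta> * \<theta>1)\<^sup>2 = \<mu>\<^sup>2 * a\<^sup>2" using unit1 by algebra
    also have "\<mu>\<^sup>2 * a\<^sup>2 = a\<^sup>2 - \<theta>\<^sup>2 * a\<^sup>2" using unit by algebra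
    also have "\<theta>\<^sup>2 * b\<^sup>2 = b\<^sup>2" using unit unit2 by algebra
    finally show ?thesis unfolding T by (simp add: algebra_simps power2_eq_square)
  qed
  have U: "\<theta> * (\<theta>\<^sup>2 * u11 + u22) = E * (2 * K + g * \<theta> * \<mu>\<^sup>2)"
  proof -
    have "\<theta> * (\<theta>\<^sup>2 * u11 + u22) = - (\<theta> * \<theta>1) * (\<theta> * u1) - E * f1 * \<theta> * (\<theta> * u1) * \<mu> - E * (\<theta>\<^sup>2 * a + d)"
      using u11 u22 by algebra
    also have "\<theta>\<^sup>2 * a + d = - 2 * K + \<kappa> * \<mu>\<^sup>2" using unit div a\<mu> by algebra
    finally show ?thesis unfolding \<theta>1 u1 g_def by (simp add: algebra_simps power2_eq_square)
  qed
  \<comment> \<open>\<open>X\<close> is the left side of \<open>hess\<close>. In its product with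
    the negative \<open>\<theta>\<close> all second derivatives can be expressed by first ones, so
    the goal becomes \<open>\<theta> * X < 0\<close>.\<close>
  define X where "X = \<theta>\<^sup>2 * (\<kappa> * u11 + E * \<theta> * (f1\<^sup>2 + f2) * u1\<^sup>2 + 2 * E * f1 * u1 * \<theta>1 + E * \<theta>11)
      + (\<kappa> * u22 + E * \<theta>22)"
  have "\<theta> * X = \<kappa> * (\<theta> * (\<theta>\<^sup>2 * u11 + u22)) + E * \<theta>\<^sup>2 * (f1\<^sup>2 + f2) * (\<theta> * u1)\<^sup>2
      + 2 * E * f1 * \<theta> * (\<theta> * u1) * (\<theta> * \<theta>1) + E * (\<theta> * (\<theta>\<^sup>2 * \<theta>11 + \<theta>22))"
    unfolding X_def by (simp add: algebra_simps power2_eq_square)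
  also have "\<dots> = E * (\<kappa> * (2 * K + g * \<theta> * \<mu>\<^sup>2) + \<theta>\<^sup>2 * (g\<^sup>2 + E\<^sup>2 * f2) * \<mu>\<^sup>2 - 2 * g * \<theta> * \<kappa> * \<mu>\<^sup>2
      - a\<^sup>2 - d\<^sup>2 - 2 * b\<^sup>2 + \<mu>\<^sup>2 * d * (d + \<kappa>)
      + 2 * \<mu>\<^sup>2 * \<theta> * (- g * E * H - g\<^sup>2 * \<theta> - E\<^sup>2 * f2 * \<theta> + g * \<kappa>))"
    unfolding Q U \<theta>K1 u1 \<theta>1 by (simp add: g_def algebra_simps power2_eq_square)
  also have "\<dots> = E * (2 * K * \<kappa> - a\<^sup>2 - d\<^sup>2 - 2 * b\<^sup>2 + \<mu>\<^sup>2 * (d * (d + \<kappa>))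
      + \<mu>\<^sup>2 * (g * \<theta> * (c - 2 * E * H) - \<theta>\<^sup>2 * E\<^sup>2 * f2))"
    unfolding \<kappa> g_def by (simp add: algebra_simps power2_eq_square)
  finally have X: "\<theta> * X = E * (2 * K * \<kappa> - a\<^sup>2 - d\<^sup>2 - 2 * b\<^sup>2 + \<mu>\<^sup>2 * (d * (d + \<kappa>))
      + \<mu>\<^sup>2 * (g * \<theta> * (c - 2 * E * H) - \<theta>\<^sup>2 * E\<^sup>2 * f2))" .
  have EH: "E * H \<ge> H" using E c by simp
  have g\<theta>: "g * \<theta> \<ge> 0" unfolding g_def using E f(1) neg by (simp add: mult_nonpos_nonpos mult_nonneg_nonpos)
  \<comment> \<open>The gap is positive by \<open>E \<ge> 1\<close> and \<open>c < H\<close>; the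
    strict inequality in both cases below rests on it.\<close>
  have K\<kappa>: "K - \<kappa> = E * H - c" unfolding K \<kappa> by (simp add: algebra_simps)
  have K0: "K > 0" unfolding K using EH c g\<theta> unfolding g_def distrib_left mult.assoc by linarith
  have pos: "K - \<kappa> > 0" using K\<kappa> EH c by linarith
  have "\<mu>\<^sup>2 * (g * \<theta> * (c - 2 * E * H) - \<theta>\<^sup>2 * E\<^sup>2 * f2) \<le> 0"
  proof -
    have "c - 2 * E * H \<le> 0" using EH c by linarith
    then have "g * \<theta> * (c - 2 * E * H) \<le> 0"
      using g\<theta> by (rule mult_nonneg_nonpos[rotated])
    moreover have "\<theta>\<^sup>2 * E\<^sup>2 * f2 \<ge> 0" using f(2) by simp
    ultimately show ?thesis by (intro mult_nonneg_nonpos) auto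
  qed
  moreover have "2 * K * \<kappa> - a\<^sup>2 - d\<^sup>2 - 2 * b\<^sup>2 + \<mu>\<^sup>2 * (d * (d + \<kappa>)) < 0"
  proof (cases "\<mu> = 0")
    case True
    \<comment> \<open>This plays the part of the bound on the norm of the shape operator: the
      squared diagonal entries sum to at least half the square of the trace
      \<open>- 2 * K\<close>.\<close>
    have "2 * (a\<^sup>2 + d\<^sup>2) \<ge> (a + d)\<^sup>2"
      using zero_le_power2[of "a - d"] by (simp add: power2_eq_square algebra_simps)
    then have "a\<^sup>2 + d\<^sup>2 \<ge> 2 * K\<^sup>2" unfolding div by (simp add: power2_eq_square)
    moreover have "K * (K - \<kappa>) > 0" using K0 pos by simp
    then have "2 * K * \<kappa> < 2 * K\<^sup>2" by (simp add: power2_eq_square algebra_simps)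
    ultimately have "2 * K * \<kappa> - a\<^sup>2 - d\<^sup>2 - 2 * b\<^sup>2 < 0" using zero_le_power2[of b] by linarith
    then show ?thesis using True by simp
  next
    case False
    then have a: "a = - \<kappa>" and b: "b = 0" using a\<mu> unit2 by auto
    then have d: "d = \<kappa> - 2 * K" using div by linarith
    have \<mu>: "\<mu>\<^sup>2 = 1 - \<theta>\<^sup>2" using unit by linarith
    \<comment> \<open>With these values the terms free of \<open>\<theta>\<close> cancel. Both
      factors left over are positive, since \<open>2 * K - \<kappa>\<close> is \<open>K\<close> plus
      the gap \<open>K - \<kappa>\<close>.\<close>
    have "2 * K * \<kappa> - a\<^sup>2 - d\<^sup>2 - 2 * b\<^sup>2 + \<mu>\<^sup>2 * (d * (d + \<kappa>)) = - 2 * \<theta>\<^sup>2 * ((2 * K - \<kappa>) * (K - \<kappa>))"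
      unfolding a b d \<mu> by (simp add: algebra_simps power2_eq_square)
    moreover have "\<theta>\<^sup>2 * ((2 * K - \<kappa>) * (K - \<kappa>)) > 0"
      using neg pos K0 by simp
    ultimately show ?thesis by linarith
  qed
  ultimately have "\<theta> * X < 0"
    unfolding X using E by (intro mult_pos_neg) auto
  moreover have "\<theta> * X \<ge> 0" using hess neg unfolding X_def[symmetric] by (simp add: mult_nonpos_nonpos)
  ultimately show False by linarith
qed

text \<open>Here \<open>m1\<close>, \<open>m2\<close> are the components of \<open>m\<close> in the frame \<open>e1\<close>, \<open>e2\<close>; orthonormality of the
  frame enters only through \<open>unit\<close> and \<open>cmc\<close>.\<close>

locale cmc_graph =
  fixes U :: "(real \<times> real) set" and e1 e2 :: "real \<times> real"
    and u \<theta> m1 m2 :: "real \<times> real \<Rightarrow> real" and f f1 f2 :: "real \<Rightarrow> real" and H :: real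
  assumes U: "open U"
    and Ck_u: "Ck_on 3 U u" and Ck_\<theta>: "Ck_on 2 U \<theta>" and Ck_m1: "Ck_on 2 U m1" and Ck_m2: "Ck_on 2 U m2"
    and f1: "\<And>t. (f has_real_derivative f1 t) (at t)"
    and f2: "\<And>t. (f1 has_real_derivative f2 t) (at t)"
    and normal1: "x \<in> U \<Longrightarrow> \<theta> x * dir_deriv e1 u x = - exp (f (u x)) * m1 x"
    and normal2: "x \<in> U \<Longrightarrow> \<theta> x * dir_deriv e2 u x = - exp (f (u x)) * m2 x"
    and unit: "x \<in> U \<Longrightarrow> (\<theta> x)\<^sup>2 + (m1 x)\<^sup>2 + (m2 x)\<^sup>2 = 1"
    and cmc: "x \<in> U \<Longrightarrow> dir_deriv e1 m1 x + dir_deriv e2 m2 x = - 2 * exp (f (u x)) * (H + f1 (u x) * \<theta> x)"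
begin

section \<open>Differentiating the equations of the locale\<close>

lemma line:
  assumes "Ck_on (Suc k) U F" "x \<in> U"
  shows "((\<lambda>s. F (x + s *\<^sub>R v)) has_real_derivative dir_deriv v F x) (at 0)"
  using has_real_derivative_line[of F x 0 v] assms unfolding Ck_on_Suc by simp

lemma Ck1:
  assumes "F \<in> {u, \<theta>, m1, m2}"
  shows "Ck_on 2 U F" "Ck_on (Suc 0) U F" "Ck_on (Suc 0) U (dir_deriv v F)"
proof -
  show 2: "Ck_on 2 U F" using assms Ck_u Ck_\<theta> Ck_m1 Ck_m2 Ck_on_le[of 3 U u 2] by auto
  then show "Ck_on (Suc 0) U F" by (rule Ck_on_le) simp
  show "Ck_on (Suc 0) U (dir_deriv v F)"
    using 2 unfolding numeral_2_eq_2 Ck_on_Suc[of "Suc 0"] by blast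
qed

lemma lines_C1:
  assumes "F \<in> {u, \<theta>, m1, m2}" "x \<in> U"
  shows "((\<lambda>s. F (x + s *\<^sub>R v)) has_real_derivative dir_deriv v F x) (at 0)"
    "((\<lambda>s. dir_deriv w F (x + s *\<^sub>R v)) has_real_derivative dir_deriv v (dir_deriv w F) x) (at 0)"
  using line[OF Ck1(2)] line[OF Ck1(3)] assms by blast+

lemma line_compose:
  assumes "\<And>t. (h has_real_derivative h' t) (at t)" "x \<in> U"
  shows "((\<lambda>s. h (u (x + s *\<^sub>R v))) has_real_derivative h' (u x) * dir_deriv v u x) (at 0)"
  using DERIV_chain2[of h "h' (u x)" "\<lambda>s. u (x + s *\<^sub>R v)" 0] assms lines_C1(1)[of u] by simp

lemma exp_f: "((\<lambda>t. exp (f t)) has_real_derivative exp (f t) * f1 t) (at t)"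
  by (rule DERIV_fun_exp[OF f1])

text \<open>Derivatives of all building blocks, in the form of introduction rules: together with
  \<open>derivative_intros\<close> they differentiate an equation term by term.\<close>

lemma lines:
  assumes "x \<in> U"
  shows "((\<lambda>s. u (x + s *\<^sub>R v)) has_real_derivative dir_deriv v u x) (at 0)"
    "((\<lambda>s. \<theta> (x + s *\<^sub>R v)) has_real_derivative dir_deriv v \<theta> x) (at 0)"
    "((\<lambda>s. m1 (x + s *\<^sub>R v)) has_real_derivative dir_deriv v m1 x) (at 0)"
    "((\<lambda>s. m2 (x + s *\<^sub>R v)) has_real_derivative dir_deriv v m2 x) (at 0)"
    "((\<lambda>s. dir_deriv w u (x + s *\<^sub>R v)) has_real_derivative dir_deriv v (dir_deriv w u) x) (at 0)"
    "((\<lambda>s. dir_deriv w \<theta> (x + s *\<^sub>R v)) has_real_derivative dir_deriv v (dir_deriv w \<theta>) x) (at 0)"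
    "((\<lambda>s. dir_deriv w m1 (x + s *\<^sub>R v)) has_real_derivative dir_deriv v (dir_deriv w m1) x) (at 0)"
    "((\<lambda>s. dir_deriv w m2 (x + s *\<^sub>R v)) has_real_derivative dir_deriv v (dir_deriv w m2) x) (at 0)"
    "((\<lambda>s. f1 (u (x + s *\<^sub>R v))) has_real_derivative f2 (u x) * dir_deriv v u x) (at 0)"
    "((\<lambda>s. exp (f (u (x + s *\<^sub>R v)))) has_real_derivative
        exp (f (u x)) * f1 (u x) * dir_deriv v u x) (at 0)"
  using lines_C1 line_compose[OF f2] line_compose[OF exp_f] assms by auto

lemmas vanishing = dir_deriv_of_vanishing[OF U]

text \<open>The proof is the model for differentiating the other equations: the identity becomes a
  function vanishing on \<open>U\<close>, \<open>lines\<close> computes its derivative, and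
  \<open>vanishing\<close> equates that to 0.\<close>

lemma d_normal1:
  assumes x: "x \<in> U"
  shows "dir_deriv v \<theta> x * dir_deriv e1 u x + \<theta> x * dir_deriv v (dir_deriv e1 u) x
    + exp (f (u x)) * f1 (u x) * dir_deriv v u x * m1 x + exp (f (u x)) * dir_deriv v m1 x = 0"
  by (rule vanishing[OF x, of "\<lambda>y. \<theta> y * dir_deriv e1 u y + exp (f (u y)) * m1 y" v])
    (use normal1 in simp, rule DERIV_cong, (rule derivative_intros lines[OF x])+, simp add: algebra_simps)

lemma d_normal2:
  assumes x: "x \<in> U"
  shows "dir_deriv v \<theta> x * dir_deriv e2 u x + \<theta> x * dir_deriv v (dir_deriv e2 u) x
    + exp (f (u x)) * f1 (u x) * dir_deriv v u x * m2 x + exp (f (u x)) * dir_deriv v m2 x = 0"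
  by (rule vanishing[OF x, of "\<lambda>y. \<theta> y * dir_deriv e2 u y + exp (f (u y)) * m2 y" v])
    (use normal2 in simp, rule DERIV_cong, (rule derivative_intros lines[OF x])+, simp add: algebra_simps)

lemma d_unit:
  assumes x: "x \<in> U"
  shows "\<theta> x * dir_deriv v \<theta> x + m1 x * dir_deriv v m1 x + m2 x * dir_deriv v m2 x = 0"
proof -
  have "2 * (\<theta> x * dir_deriv v \<theta> x + m1 x * dir_deriv v m1 x + m2 x * dir_deriv v m2 x) = 0"
    by (rule vanishing[OF x, of "\<lambda>y. \<theta> y * \<theta> y + m1 y * m1 y + m2 y * m2 y - 1" v])
      (use unit in \<open>simp add: power2_eq_square\<close>,
        rule DERIV_cong, (rule derivative_intros lines[OF x])+, simp add: algebra_simps)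
  then show ?thesis by simp
qed

lemma dd_unit:
  assumes x: "x \<in> U"
  shows "(dir_deriv v \<theta> x)\<^sup>2 + \<theta> x * dir_deriv v (dir_deriv v \<theta>) x
    + (dir_deriv v m1 x)\<^sup>2 + m1 x * dir_deriv v (dir_deriv v m1) x
    + (dir_deriv v m2 x)\<^sup>2 + m2 x * dir_deriv v (dir_deriv v m2) x = 0"
  by (rule vanishing[OF x, of "\<lambda>y. \<theta> y * dir_deriv v \<theta> y + m1 y * dir_deriv v m1 y
      + m2 y * dir_deriv v m2 y" v])
    (use d_unit in simp, rule DERIV_cong, (rule derivative_intros lines[OF x])+,
      simp add: algebra_simps power2_eq_square)

lemma d_cmc:
  assumes x: "x \<in> U"
  shows "dir_deriv v (dir_deriv e1 m1) x + dir_deriv v (dir_deriv e2 m2) x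
    + 2 * (exp (f (u x)) * f1 (u x) * dir_deriv v u x * (H + f1 (u x) * \<theta> x)
      + exp (f (u x)) * (f2 (u x) * dir_deriv v u x * \<theta> x + f1 (u x) * dir_deriv v \<theta> x)) = 0"
  by (rule vanishing[OF x, of "\<lambda>y. dir_deriv e1 m1 y + dir_deriv e2 m2 y
      + 2 * (exp (f (u y)) * (H + f1 (u y) * \<theta> y))" v])
    (use cmc in simp, rule DERIV_cong, (rule derivative_intros lines[OF x])+, simp add: algebra_simps)

text \<open>Integrability condition. Where \<open>\<theta> \<noteq> 0\<close>, the field
  \<open>m/\<theta>\<close> is minus the gradient of a primitive of exp(-f) evaluated at
  \<open>u\<close>, hence curl-free. To avoid division, the cross derivatives of the two normal
  equations are compared; the mixed derivatives of \<open>u\<close> and the terms with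
  \<open>f1\<close> cancel.\<close>

lemma codazzi:
  assumes x: "x \<in> U"
  shows "dir_deriv e2 \<theta> x * m1 x - dir_deriv e1 \<theta> x * m2 x
    = \<theta> x * (dir_deriv e2 m1 x - dir_deriv e1 m2 x)"
proof -
  have comm: "dir_deriv e2 (dir_deriv e1 u) x = dir_deriv e1 (dir_deriv e2 u) x"
    by (rule dir_deriv_commute[OF U x Ck1(1)]) simp
  have alg: "E * (t2 * p - t1 * q - t * (p2 - q1)) = 0"
    if "t2 * u1 + t * u12 + E * g * u2 * p + E * p2 = 0" "t1 * u2 + t * u12 + E * g * u1 * q + E * q1 = 0"
      "t * u1 = - E * p" "t * u2 = - E * q" for E g t t1 t2 p q p2 q1 u1 u2 u12 :: real
    using that by algebra
  have "exp (f (u x)) * (dir_deriv e2 \<theta> x * m1 x - dir_deriv e1 \<theta> x * m2 x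
    - \<theta> x * (dir_deriv e2 m1 x - dir_deriv e1 m2 x)) = 0"
    by (rule alg[OF d_normal1[OF x, of e2] d_normal2[OF x, of e1, folded comm] normal1[OF x] normal2[OF x]])
  then show ?thesis by simp
qed

lemma d_codazzi:
  assumes x: "x \<in> U"
  shows "dir_deriv v (dir_deriv e2 \<theta>) x * m1 x + dir_deriv e2 \<theta> x * dir_deriv v m1 x
    - dir_deriv v (dir_deriv e1 \<theta>) x * m2 x - dir_deriv e1 \<theta> x * dir_deriv v m2 x
    - dir_deriv v \<theta> x * (dir_deriv e2 m1 x - dir_deriv e1 m2 x)
    - \<theta> x * (dir_deriv v (dir_deriv e2 m1) x - dir_deriv v (dir_deriv e1 m2) x) = 0"
  by (rule vanishing[OF x, of "\<lambda>y. dir_deriv e2 \<theta> y * m1 y - dir_deriv e1 \<theta> y * m2 y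
    - \<theta> y * (dir_deriv e2 m1 y - dir_deriv e1 m2 y)" v])
    (use codazzi in simp, rule DERIV_cong, (rule derivative_intros lines[OF x])+, simp add: algebra_simps)

text \<open>In a frame with \<open>m2 x = 0\<close> the differentiated identities at
  \<open>x\<close> become the hypotheses of \<open>cmc_max_principle_algebra\<close>. Regularity of
  the conformal factor is assumed separately because the locale does not make \<open>f2\<close>
  continuous.\<close>

lemma no_interior_max:
  assumes x: "x \<in> U" and max: "\<And>y. y \<in> U \<Longrightarrow>
      c * u y + exp (f (u y)) * \<theta> y \<le> c * u x + exp (f (u x)) * \<theta> x"
    and m2: "m2 x = 0" and neg: "\<theta> x < 0" and c: "0 < c" "c < H"
    and f: "f (u x) \<ge> 0" "f1 (u x) \<le> 0" "f2 (u x) \<ge> 0"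
    and Ck_E: "Ck_on 2 U (\<lambda>y. exp (f (u y)))"
  shows False
proof -
  let ?E = "exp (f (u x))"
  define \<phi> where "\<phi> y = c * u y + exp (f (u y)) * \<theta> y" for y
  have Ck_\<phi>: "Ck_on 2 U \<phi>"
    unfolding \<phi>_def using Ck_on_scaleR[OF U Ck_on_const Ck1(1), of u c] Ck_on_scaleR[OF U Ck_E Ck_\<theta>]
    by (intro Ck_on_add[OF U]) simp_all
  have max\<phi>: "\<phi> y \<le> \<phi> x" if "y \<in> U" for y
    using max that by (simp add: \<phi>_def)
  have line_\<phi>: "((\<lambda>s. \<phi> (y + s *\<^sub>R v)) has_real_derivative c * dir_deriv v u y
      + exp (f (u y)) * f1 (u y) * dir_deriv v u y * \<theta> y + exp (f (u y)) * dir_deriv v \<theta> y) (at 0)"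
    if y: "y \<in> U" for y v
    unfolding \<phi>_def
    by (rule DERIV_cong, (rule derivative_intros lines[OF y])+, simp add: algebra_simps)
  have d\<phi>: "dir_deriv v \<phi> y = c * dir_deriv v u y
      + exp (f (u y)) * f1 (u y) * dir_deriv v u y * \<theta> y + exp (f (u y)) * dir_deriv v \<theta> y"
    if y: "y \<in> U" for y v
    using dir_deriv_eq_line[OF _ line_\<phi>[OF y]] Ck_\<phi> y
    unfolding numeral_2_eq_2 Ck_on_Suc by blast
  have line_d\<phi>: "((\<lambda>s. dir_deriv v \<phi> (x + s *\<^sub>R v)) has_real_derivative dir_deriv v (dir_deriv v \<phi>) x) (at 0)" for v
    using Ck_\<phi> x unfolding numeral_2_eq_2 Ck_on_Suc[of "Suc 0"] by (blast intro: line)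
  have dd\<phi>: "dir_deriv v (dir_deriv v \<phi>) x = (c + ?E * f1 (u x) * \<theta> x) * dir_deriv v (dir_deriv v u) x
      + ?E * \<theta> x * ((f1 (u x))\<^sup>2 + f2 (u x)) * (dir_deriv v u x)\<^sup>2
      + 2 * ?E * f1 (u x) * dir_deriv v u x * dir_deriv v \<theta> x + ?E * dir_deriv v (dir_deriv v \<theta>) x" for v
  proof -
    have "dir_deriv v (dir_deriv v \<phi>) x - ((c + ?E * f1 (u x) * \<theta> x) * dir_deriv v (dir_deriv v u) x
      + ?E * \<theta> x * ((f1 (u x))\<^sup>2 + f2 (u x)) * (dir_deriv v u x)\<^sup>2
      + 2 * ?E * f1 (u x) * dir_deriv v u x * dir_deriv v \<theta> x + ?E * dir_deriv v (dir_deriv v \<theta>) x) = 0"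
      by (rule vanishing[OF x, of "\<lambda>y. dir_deriv v \<phi> y - (c * dir_deriv v u y
      + exp (f (u y)) * f1 (u y) * dir_deriv v u y * \<theta> y + exp (f (u y)) * dir_deriv v \<theta> y)" v])
        (use d\<phi> in simp, rule DERIV_cong, (rule derivative_intros lines[OF x] line_d\<phi>)+,
          simp add: algebra_simps power2_eq_square)
    then show ?thesis by simp
  qed
  note crit = dir_deriv_at_local_max[OF U x Ck_\<phi> max\<phi>]
  \<comment> \<open>To first order \<open>u\<close> is constant along the second frame direction;
    criticality of \<open>\<phi>\<close> then gives the same for \<open>\<theta>\<close>.\<close>
  have u2: "dir_deriv e2 u x = 0" using normal2[OF x] m2 neg by simp
  have \<theta>2: "dir_deriv e2 \<theta> x = 0" using crit(1)[of e2] d\<phi>[OF x, of e2] u2 by simp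
  have b: "dir_deriv e2 m1 x = dir_deriv e1 m2 x" using codazzi[OF x] m2 \<theta>2 neg by simp
  have w: "dir_deriv e1 (dir_deriv e2 m2) x = dir_deriv e2 (dir_deriv e1 m2) x"
    by (rule dir_deriv_commute[OF U x Ck_m2])
  show False
  proof (rule cmc_max_principle_algebra[of "\<theta> x" "m1 x" "dir_deriv e1 u x" ?E
        "c + ?E * f1 (u x) * \<theta> x" "dir_deriv e1 \<theta> x" c "f1 (u x)" "?E * (H + f1 (u x) * \<theta> x)" H
        "dir_deriv e1 m1 x" "dir_deriv e1 m2 x" "dir_deriv e2 m2 x"
        "dir_deriv e1 (dir_deriv e1 \<theta>) x" "dir_deriv e1 (dir_deriv e1 m1) x"
        "dir_deriv e2 (dir_deriv e2 \<theta>) x" "dir_deriv e2 (dir_deriv e2 m1) x"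
        "dir_deriv e2 (dir_deriv e1 m2) x"
        "?E * f1 (u x) * dir_deriv e1 u x * (H + f1 (u x) * \<theta> x)
          + ?E * (f2 (u x) * dir_deriv e1 u x * \<theta> x + f1 (u x) * dir_deriv e1 \<theta> x)"
        "f2 (u x)" "dir_deriv e1 (dir_deriv e1 u) x" "dir_deriv e2 (dir_deriv e2 u) x"])
    show "(\<theta> x)\<^sup>2 + (m1 x)\<^sup>2 = 1" using unit[OF x] m2 by simp
    show "\<theta> x * dir_deriv e1 u x = - ?E * m1 x" by (rule normal1[OF x])
    show "(c + ?E * f1 (u x) * \<theta> x) * dir_deriv e1 u x + ?E * dir_deriv e1 \<theta> x = 0"
      using crit(1)[of e1] d\<phi>[OF x, of e1] by (simp add: algebra_simps)
    show "\<theta> x * dir_deriv e1 \<theta> x + m1 x * dir_deriv e1 m1 x = 0"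
      using d_unit[OF x, of e1] m2 by simp
    show "m1 x * dir_deriv e1 m2 x = 0"
      using d_unit[OF x, of e2] m2 \<theta>2 b by simp
    show "dir_deriv e1 m1 x + dir_deriv e2 m2 x = - 2 * (?E * (H + f1 (u x) * \<theta> x))"
      using cmc[OF x] by simp
    show "(dir_deriv e1 \<theta> x)\<^sup>2 + \<theta> x * dir_deriv e1 (dir_deriv e1 \<theta>) x + (dir_deriv e1 m1 x)\<^sup>2
      + (dir_deriv e1 m2 x)\<^sup>2 + m1 x * dir_deriv e1 (dir_deriv e1 m1) x = 0"
      using dd_unit[OF x, of e1] m2 by simp
    show "\<theta> x * dir_deriv e2 (dir_deriv e2 \<theta>) x + (dir_deriv e1 m2 x)\<^sup>2 + (dir_deriv e2 m2 x)\<^sup>2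
      + m1 x * dir_deriv e2 (dir_deriv e2 m1) x = 0"
      using dd_unit[OF x, of e2] m2 \<theta>2 b by simp
    show "dir_deriv e2 (dir_deriv e2 \<theta>) x * m1 x - dir_deriv e1 \<theta> x * dir_deriv e2 m2 x
      = \<theta> x * (dir_deriv e2 (dir_deriv e2 m1) x - dir_deriv e2 (dir_deriv e1 m2) x)"
      using d_codazzi[OF x, of e2] m2 \<theta>2 by simp
    show "dir_deriv e1 (dir_deriv e1 m1) x + dir_deriv e2 (dir_deriv e1 m2) x
      = - 2 * (?E * f1 (u x) * dir_deriv e1 u x * (H + f1 (u x) * \<theta> x)
          + ?E * (f2 (u x) * dir_deriv e1 u x * \<theta> x + f1 (u x) * dir_deriv e1 \<theta> x))"
      using d_cmc[OF x, of e1] w by simp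
    show "dir_deriv e1 \<theta> x * dir_deriv e1 u x + \<theta> x * dir_deriv e1 (dir_deriv e1 u) x
      = - ?E * f1 (u x) * dir_deriv e1 u x * m1 x - ?E * dir_deriv e1 m1 x"
      using d_normal1[OF x, of e1] by simp
    show "\<theta> x * dir_deriv e2 (dir_deriv e2 u) x = - ?E * dir_deriv e2 m2 x"
      using d_normal2[OF x, of e2] u2 \<theta>2 m2 by simp
    \<comment> \<open>The inverse of the induced metric is diagonal in this frame, so only pure
      second derivatives occur, each nonpositive at the maximum.\<close>
    have "(\<theta> x)\<^sup>2 * dir_deriv e1 (dir_deriv e1 \<phi>) x + dir_deriv e2 (dir_deriv e2 \<phi>) x \<le> 0"
      using crit(2)[of e1] crit(2)[of e2] by (intro add_nonpos_nonpos mult_nonneg_nonpos) auto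
    then show "(\<theta> x)\<^sup>2 * ((c + ?E * f1 (u x) * \<theta> x) * dir_deriv e1 (dir_deriv e1 u) x
      + ?E * \<theta> x * ((f1 (u x))\<^sup>2 + f2 (u x)) * (dir_deriv e1 u x)\<^sup>2
      + 2 * ?E * f1 (u x) * dir_deriv e1 u x * dir_deriv e1 \<theta> x + ?E * dir_deriv e1 (dir_deriv e1 \<theta>) x)
      + ((c + ?E * f1 (u x) * \<theta> x) * dir_deriv e2 (dir_deriv e2 u) x + ?E * dir_deriv e2 (dir_deriv e2 \<theta>) x) \<le> 0"
      unfolding dd\<phi> using u2 by simp
    show "?E \<ge> 1" using f(1) by simp
  qed (use neg c f in auto)
qed

text \<open>Comparison with the slice through the highest point, whose mean curvature for the upward
  normal is \<open>- f1 (u x)\<close>. There \<open>m\<close> vanishes with the gradient of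
  \<open>u\<close>, so \<open>\<theta> x = 1\<close>, and the trace of the Hessian of
  \<open>u\<close> is a positive multiple of \<open>H + f1 (u x)\<close>.\<close>

lemma curvature_at_max:
  assumes x: "x \<in> U" and max: "\<And>y. y \<in> U \<Longrightarrow> u y \<le> u x" and pos: "\<theta> x > 0"
  shows "H \<le> - f1 (u x)"
proof -
  let ?E = "exp (f (u x))"
  note crit = dir_deriv_at_local_max[OF U x Ck1(1)[of u] max]
  have m: "m1 x = 0" "m2 x = 0" using normal1[OF x] normal2[OF x] crit(1) by auto
  then have \<theta>: "\<theta> x = 1" using unit[OF x] pos by (simp add: power2_eq_1_iff)
  have "dir_deriv e1 (dir_deriv e1 u) x = - ?E * dir_deriv e1 m1 x"
    "dir_deriv e2 (dir_deriv e2 u) x = - ?E * dir_deriv e2 m2 x"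
    using d_normal1[OF x, of e1] d_normal2[OF x, of e2] m \<theta> crit(1) by simp_all
  then have "- ?E * (dir_deriv e1 m1 x + dir_deriv e2 m2 x) \<le> 0"
    using crit(2)[of e1] crit(2)[of e2] by (simp add: algebra_simps)
  then have "2 * ?E * ?E * (H + f1 (u x)) \<le> 0"
    unfolding cmc[OF x] \<theta> by (simp add: algebra_simps)
  then show ?thesis by (simp add: mult_le_0_iff)
qed

end

section \<open>Tangent planes and boundary of a graph\<close>

lemma Ck_on_exp: "Ck_on k UNIV (exp :: real \<Rightarrow> real)"
proof (induction k)
  case (Suc k)
  have D: "(exp has_derivative (\<lambda>v. exp x * v)) (at x)" for x :: real
    using DERIV_exp[of x] by (simp add: has_field_derivative_def)
  have "dir_deriv v exp = (\<lambda>x::real. v *\<^sub>R exp x)" for v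
    using dir_deriv_eqI[OF D] by (auto simp: fun_eq_iff)
  then have "Ck_on k UNIV (dir_deriv v (exp :: real \<Rightarrow> real))" for v
    using Ck_on_scaleR[OF open_UNIV Ck_on_const Suc] by simp
  then show ?case unfolding Ck_on_Suc using D by (auto simp: differentiable_def)
qed (simp add: continuous_on_exp)

text \<open>The basis in \<open>trace_on\<close> is an arbitrary choice, so computing with it
  requires independence of the basis. This follows by expanding each \<open>b\<close> in
  \<open>C\<close> and each \<open>T c\<close> in \<open>B\<close> and exchanging the two
  sums.\<close>

lemma trace_on_basis:
  fixes C :: "'a::euclidean_space set"
  assumes C: "independent C" "span C = V" and T: "linear T" "\<And>c. c \<in> C \<Longrightarrow> T c \<in> V"
  shows "trace_on V T = (\<Sum>c\<in>C. representation C (T c) c)"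
proof -
  define B where "B = (SOME B. independent B \<and> span B = V)"
  have "independent B \<and> span B = V"
    unfolding B_def by (rule someI[of _ C]) (use C in simp)
  then have B: "independent B" "span B = V" by auto
  have fin: "finite B" "finite C" using B C independent_imp_finite by auto
  have eqC: "(\<Sum>c\<in>C. representation C v c *\<^sub>R c) = v" and eqB: "(\<Sum>b\<in>B. representation B v b *\<^sub>R b) = v"
    if "v \<in> V" for v
    using that B C fin real_vector.sum_representation_eq by blast+
  have inV: "b \<in> V" if "b \<in> B" for b using B that span_base by blast
  have "(\<Sum>b\<in>B. representation B (T b) b) = (\<Sum>b\<in>B. \<Sum>c\<in>C. representation C b c * representation B (T c) b)"
  proof (rule sum.cong[OF refl])
    fix b assume b: "b \<in> B"
    have "T b = (\<Sum>c\<in>C. representation C b c *\<^sub>R T c)"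
      by (subst eqC[OF inV[OF b], symmetric]) (simp add: linear_sum[OF T(1)] linear_scale[OF T(1)])
    then show "representation B (T b) b = (\<Sum>c\<in>C. representation C b c * representation B (T c) b)"
      using B(1) T(2)[folded B(2)] by (simp add: real_vector.representation_sum
          real_vector.representation_scale real_vector.span_scale)
  qed
  also have "\<dots> = (\<Sum>c\<in>C. \<Sum>b\<in>B. representation B (T c) b * representation C b c)"
    by (subst sum.swap) (simp add: mult.commute)
  also have "\<dots> = (\<Sum>c\<in>C. representation C (T c) c)"
  proof (rule sum.cong[OF refl])
    fix c assume c: "c \<in> C"
    have "representation C (T c) c = representation C (\<Sum>b\<in>B. representation B (T c) b *\<^sub>R b) c"
      using eqB T(2) c by simp
    also have "\<dots> = (\<Sum>b\<in>B. representation B (T c) b * representation C b c)"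
      using C(1) inV[folded C(2)] by (simp add: real_vector.representation_sum
          real_vector.representation_scale real_vector.span_scale)
    finally show "(\<Sum>b\<in>B. representation B (T c) b * representation C b c) = representation C (T c) c"
      by simp
  qed
  finally show ?thesis unfolding trace_on_def B_def by (simp add: Let_def)
qed

section \<open>The graph map, its parametrizations, tangent planes and boundary points\<close>

lemma dir_deriv_works:
  "F differentiable at x \<Longrightarrow> (F has_derivative (\<lambda>v. dir_deriv v F x)) (at x)"
  by (simp add: dir_deriv_def frechet_derivative_works)

lemma has_derivative_graph:
  "u differentiable at q \<Longrightarrow> ((\<lambda>q. (u q, q)) has_derivative (\<lambda>v. (dir_deriv v u q, v))) (at q)"
  by (intro has_derivative_Pair dir_deriv_works has_derivative_ident)

lemma has_derivative_shifted_graph: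
  fixes \<tau> :: "'a::euclidean_space"
  assumes "u differentiable at (a + \<tau>)"
  shows "((\<lambda>a. (u (a + \<tau>), a + \<tau>)) has_derivative (\<lambda>v. (dir_deriv v u (a + \<tau>), v))) (at a)"
proof -
  have "((\<lambda>a. a + \<tau>) has_derivative (\<lambda>v. v)) (at a)"
    by (auto intro!: derivative_eq_intros)
  from has_derivative_compose[OF this has_derivative_graph[OF assms]] show ?thesis .
qed

context
  fixes D :: "(real \<times> real) set" and u :: "real \<times> real \<Rightarrow> real" and \<Sigma> :: "point set"
  assumes graph: "compact_graph D u \<Sigma>"
begin

lemma graph_eq: "\<Sigma> = (\<lambda>q. (u q, q)) ` D"
  using graph by (simp add: compact_graph_def)

lemma graph_memI: "q \<in> D \<Longrightarrow> (u q, q) \<in> \<Sigma>"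
  by (simp add: graph_eq)

lemma graph_point:
  assumes "p \<in> \<Sigma>"
  shows "snd p \<in> D" "(u (snd p), snd p) = p"
  using assms by (auto simp: graph_eq)

lemma Ck_on_graph: "Ck_on k (interior D) u"
  using graph by (simp add: compact_graph_def smooth_on_def)

lemma graph_differentiable: "q \<in> interior D \<Longrightarrow> u differentiable at q"
  using Ck_on_graph[of 1] by simp

lemma Ck_on_graph_map: "Ck_on k (interior D) (\<lambda>q. (u q, q))"
  by (intro Ck_on_Pair Ck_on_graph Ck_on_ident) simp

text \<open>The shift \<open>\<tau>\<close> moves the domain into the interior of the half-plane.\<close>

lemma local_parametrization_graph:
  assumes r: "r > 0" "ball q r \<subseteq> interior D" and \<tau>: "\<tau> = (0, snd q - 2 * r)"
  shows "local_parametrization \<Sigma> (ball (q - \<tau>) r) (\<lambda>a. (u (a + \<tau>), a + \<tau>))"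
proof -
  let ?U = "ball (q - \<tau>) r" and ?\<phi> = "\<lambda>a. (u (a + \<tau>), a + \<tau>)"
  have im: "(\<lambda>a. a + \<tau>) ` ?U = ball q r"
  proof -
    have "(\<lambda>a. a + \<tau>) ` ?U = (+) \<tau> ` ?U" by (auto simp: add.commute)
    then show ?thesis using image_add_ball[of \<tau> "q - \<tau>" r] by simp
  qed
  have half: "?U \<inter> half_plane = ?U"
  proof -
    have "snd a \<ge> 0" if "a \<in> ?U" for a
    proof -
      have "\<bar>snd (q - \<tau>) - snd a\<bar> < r"
        using that dist_snd_le[of "q - \<tau>" a] unfolding mem_ball dist_real_def by linarith
      then show ?thesis by (simp add: \<tau>)
    qed
    then show ?thesis by (auto simp: half_plane_def)
  qed
  have Ck: "Ck_on k ?U ?\<phi>" for k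
    using im r by (intro Ck_on_compose[of ?U "interior D" "\<lambda>a. a + \<tau>" k "\<lambda>q. (u q, q)"]
        Ck_on_add Ck_on_ident Ck_on_const Ck_on_graph_map) auto
  have inj: "inj (frechet_derivative ?\<phi> (at a))" if "a \<in> ?U" for a
  proof -
    have "a + \<tau> \<in> interior D" using that im r by blast
    then have "(?\<phi> has_derivative (\<lambda>v. (dir_deriv v u (a + \<tau>), v))) (at a)"
      by (intro has_derivative_shifted_graph graph_differentiable)
    then have "frechet_derivative ?\<phi> (at a) = (\<lambda>v. (dir_deriv v u (a + \<tau>), v))"
      by (rule frechet_derivative_at[symmetric])
    then show ?thesis by (auto simp: inj_def)
  qed
  have "?\<phi> ` ?U = (\<lambda>q. (u q, q)) ` ball q r"
    unfolding im[symmetric] by (simp add: image_image)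
  also have "\<dots> = \<Sigma> \<inter> snd -` ball q r"
    using r interior_subset[of D] unfolding graph_eq by auto
  finally have img: "?\<phi> ` ?U = \<Sigma> \<inter> snd -` ball q r" .
  have op: "openin (top_of_set \<Sigma>) (?\<phi> ` ?U)"
    unfolding img by (intro openin_open_Int open_vimage continuous_intros) simp
  have "homeomorphism ?U (?\<phi> ` ?U) ?\<phi> (\<lambda>p. snd p - \<tau>)"
    by (rule homeomorphismI[OF Ck_on_imp_continuous_on[OF Ck]]) (auto intro!: continuous_intros)
  then show ?thesis
    unfolding local_parametrization_def smooth_on_def half using Ck inj op by blast
qed

text \<open>Any parametrization takes values in the graph, so it is the graph map applied to its own
  horizontal part; comparing derivatives gives one inclusion. The shifted graph map is a
  parametrization that attains all the vectors.\<close>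

lemma tangent_plane_graph:
  assumes q: "q \<in> interior D"
  shows "tangent_plane \<Sigma> (u q, q) = {X. fst X = dir_deriv (snd X) u q}"
proof (intro set_eqI iffI)
  fix X assume "X \<in> tangent_plane \<Sigma> (u q, q)"
  then obtain U \<phi> a v where lp: "local_parametrization \<Sigma> U \<phi>" and a: "a \<in> U \<inter> half_plane" "\<phi> a = (u q, q)"
    and X: "X = frechet_derivative \<phi> (at a) v"
    unfolding tangent_plane_def by blast
  let ?L = "frechet_derivative \<phi> (at a)"
  have U: "open U" and sub: "\<phi> ` (U \<inter> half_plane) \<subseteq> \<Sigma>" and Ck: "\<And>k. Ck_on k U \<phi>"
    using lp unfolding local_parametrization_def smooth_on_def by (blast dest: openin_imp_subset)+
  have D1: "(\<phi> has_derivative ?L) (at a)"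
    using Ck[of 1] a by (simp add: frechet_derivative_works)
  have D2: "((\<lambda>b. (u (snd (\<phi> b)), snd (\<phi> b))) has_derivative (\<lambda>v. (dir_deriv (snd (?L v)) u q, snd (?L v)))) (at a)"
    using has_derivative_compose[OF has_derivative_snd[OF D1], of "\<lambda>q. (u q, q)"]
      has_derivative_graph[OF graph_differentiable[OF q]] a(2) by simp
  have eq: "(u (snd (\<phi> b)), snd (\<phi> b)) = \<phi> b" if "b \<in> U \<inter> half_plane" for b
    using sub that by (intro graph_point(2)) blast
  have D3: "(\<phi> has_derivative (\<lambda>v. (dir_deriv (snd (?L v)) u q, snd (?L v)))) (at a within U \<inter> half_plane)"
    by (rule has_derivative_transform[OF a(1) _ has_derivative_at_withinI[OF D2]]) (simp add: eq)
  \<comment> \<open>The two maps agree on the half-plane only. Uniqueness of the derivative persists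
    at its edge, because small positive steps along the basis vectors stay inside.\<close>
  have "?L = (\<lambda>v. (dir_deriv (snd (?L v)) u q, snd (?L v)))"
  proof (rule frechet_derivative_unique_within[OF has_derivative_at_withinI[OF D1] D3])
    fix i :: "real \<times> real" and e :: real assume i: "i \<in> Basis" and e: "e > 0"
    obtain r where r: "r > 0" "ball a r \<subseteq> U" using U a(1) by (meson IntD1 open_contains_ball)
    have "snd i \<ge> 0" using i by (auto simp: Basis_prod_def)
    moreover obtain t where t: "0 < t" "t < r" "t < e"
      using r(1) e by (metis field_lbound_gt_zero)
    ultimately have "snd (a + t *\<^sub>R i) \<ge> 0" using a(1) by (simp add: half_plane_def)
    moreover have "dist a (a + t *\<^sub>R i) = t" using i t by (simp add: dist_norm)
    then have "a + t *\<^sub>R i \<in> U" using t r(2) by (metis mem_ball subsetD)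
    ultimately show "\<exists>d. 0 < \<bar>d\<bar> \<and> \<bar>d\<bar> < e \<and> a + d *\<^sub>R i \<in> U \<inter> half_plane"
      using t by (intro exI[of _ t]) (simp add: half_plane_def)
  qed
  from fun_cong[OF this, of v] have "fst X = dir_deriv (snd X) u q"
    unfolding X[symmetric] by (rule arg_cong[of _ "(_, _)" fst, simplified])
  then show "X \<in> {X. fst X = dir_deriv (snd X) u q}" by simp
next
  fix X :: point assume X: "X \<in> {X. fst X = dir_deriv (snd X) u q}"
  obtain r where r: "r > 0" "ball q r \<subseteq> interior D"
    using q by (meson open_contains_ball open_interior)
  define \<tau> where "\<tau> = (0::real, snd q - 2 * r)"
  have lp: "local_parametrization \<Sigma> (ball (q - \<tau>) r) (\<lambda>a. (u (a + \<tau>), a + \<tau>))"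
    by (rule local_parametrization_graph[OF r \<tau>_def])
  have "((\<lambda>a. (u (a + \<tau>), a + \<tau>)) has_derivative (\<lambda>v. (dir_deriv v u q, v))) (at (q - \<tau>))"
    using has_derivative_shifted_graph[of u "q - \<tau>" \<tau>] graph_differentiable[OF q] by simp
  then have "frechet_derivative (\<lambda>a. (u (a + \<tau>), a + \<tau>)) (at (q - \<tau>)) = (\<lambda>v. (dir_deriv v u q, v))"
    by (rule frechet_derivative_at[symmetric])
  then have "X = frechet_derivative (\<lambda>a. (u (a + \<tau>), a + \<tau>)) (at (q - \<tau>)) (snd X)"
    using X by (simp add: prod_eq_iff)
  moreover have "q - \<tau> \<in> ball (q - \<tau>) r \<inter> half_plane"
    using r by (simp add: half_plane_def \<tau>_def)
  moreover have "(u (q - \<tau> + \<tau>), q - \<tau> + \<tau>) = (u q, q)" by simp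
  ultimately show "X \<in> tangent_plane \<Sigma> (u q, q)"
    using lp unfolding tangent_plane_def by blast
qed

text \<open>At a parameter off the edge, the horizontal projection of the parametrization is
  continuous and, on a graph, injective on an open set. By invariance of domain its image is then an
  open subset of \<open>D\<close> containing \<open>q\<close>, a contradiction.\<close>

lemma frontier_in_surface_boundary:
  assumes q: "q \<in> D" "q \<notin> interior D"
  shows "(u q, q) \<in> surface_boundary \<Sigma>"
proof -
  have "(u q, q) \<in> \<Sigma>" using q by (simp add: graph_eq)
  then obtain U \<phi> a where lp: "local_parametrization \<Sigma> U \<phi>" and a: "a \<in> U \<inter> half_plane" "\<phi> a = (u q, q)"
    using graph unfolding compact_graph_def surface_with_boundary_def by fastforce
  have "snd a = 0"
  proof (rule ccontr)
    assume "snd a \<noteq> 0"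
    define V where "V = U \<inter> {a. snd a > 0}"
    have U: "open U" and sub: "\<phi> ` (U \<inter> half_plane) \<subseteq> \<Sigma>" and Ck: "Ck_on 0 U \<phi>"
      using lp unfolding local_parametrization_def smooth_on_def by (blast dest: openin_imp_subset)+
    obtain \<psi> where "homeomorphism (U \<inter> half_plane) (\<phi> ` (U \<inter> half_plane)) \<phi> \<psi>"
      using lp unfolding local_parametrization_def by blast
    then have inj: "inj_on \<phi> (U \<inter> half_plane)"
      by (metis homeomorphism_apply1 inj_on_inverseI)
    have VU: "V \<subseteq> U \<inter> half_plane" by (auto simp: V_def half_plane_def)
    have "open V" unfolding V_def
      by (intro open_Int U open_Collect_less continuous_intros)
    moreover have "continuous_on V (\<lambda>b. snd (\<phi> b))"
      using Ck VU by (intro continuous_intros) (auto intro: continuous_on_subset)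
    moreover have "inj_on (\<lambda>b. snd (\<phi> b)) V"
    proof (rule inj_onI)
      fix b c assume bc: "b \<in> V" "c \<in> V" "snd (\<phi> b) = snd (\<phi> c)"
      have "\<phi> b \<in> \<Sigma>" "\<phi> c \<in> \<Sigma>" using sub VU bc by blast+
      from this[THEN graph_point(2)] have "\<phi> b = \<phi> c" using bc(3) by metis
      then show "b = c"
        using inj bc VU by (meson inj_onD subsetD)
    qed
    ultimately have "open ((\<lambda>b. snd (\<phi> b)) ` V)" using invariance_of_domain by blast
    moreover have "(\<lambda>b. snd (\<phi> b)) ` V \<subseteq> D"
      using sub VU graph_point(1) by blast
    moreover have "a \<in> V" using a(1) \<open>snd a \<noteq> 0\<close> by (simp add: V_def half_plane_def)
    then have "q \<in> (\<lambda>b. snd (\<phi> b)) ` V" using a(2) by (intro image_eqI[of _ _ a]) simp_all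
    ultimately show False using q(2) interior_maximal[of "(\<lambda>b. snd (\<phi> b)) ` V" D] by blast
  qed
  then show ?thesis using lp a(1) a(2)[symmetric] unfolding surface_boundary_def by blast
qed

end

section \<open>The trace on a tangent plane of a graph\<close>

lemma representation_pair:
  assumes "independent {X, Y}" "X \<noteq> Y"
  shows "representation {X, Y} (\<alpha> *\<^sub>R X + \<beta> *\<^sub>R Y) X = \<alpha>" "representation {X, Y} (\<alpha> *\<^sub>R X + \<beta> *\<^sub>R Y) Y = \<beta>"
proof -
  have "representation {X, Y} (\<alpha> *\<^sub>R X + \<beta> *\<^sub>R Y)
      = (\<lambda>b. \<alpha> * representation {X, Y} X b + \<beta> * representation {X, Y} Y b)"
    using assms(1) by (simp add: real_vector.representation_add real_vector.representation_scale
        real_vector.span_scale real_vector.span_base)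
  then show "representation {X, Y} (\<alpha> *\<^sub>R X + \<beta> *\<^sub>R Y) X = \<alpha>"
    "representation {X, Y} (\<alpha> *\<^sub>R X + \<beta> *\<^sub>R Y) Y = \<beta>"
    using assms by (simp_all add: real_vector.representation_basis)
qed

lemma rotated_basis:
  fixes z :: "real \<times> real"
  assumes "a\<^sup>2 + b\<^sup>2 = 1"
  shows "(z \<bullet> (a, b)) *\<^sub>R (a, b) + (z \<bullet> (- b, a)) *\<^sub>R (- b, a) = z"
    and "(z \<bullet> (a, b))\<^sup>2 + (z \<bullet> (- b, a))\<^sup>2 = z \<bullet> z"
proof -
  obtain x y where z: "z = (x, y)" by fastforce
  have "(x * a + y * b) * a - (y * a - x * b) * b = x" "(x * a + y * b) * b + (y * a - x * b) * a = y"
    "(x * a + y * b)\<^sup>2 + (y * a - x * b)\<^sup>2 = x * x + y * y"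
    using assms by algebra+
  then show "(z \<bullet> (a, b)) *\<^sub>R (a, b) + (z \<bullet> (- b, a)) *\<^sub>R (- b, a) = z"
    "(z \<bullet> (a, b))\<^sup>2 + (z \<bullet> (- b, a))\<^sup>2 = z \<bullet> z"
    unfolding z by (simp_all add: algebra_simps)
qed

text \<open>The lifts of a Euclidean orthonormal frame form a basis of the plane. Coordinates in it
  are Euclidean products of the horizontal part with the frame, although the lifts are in general
  not orthogonal.\<close>

lemma trace_on_graph_plane:
  fixes l :: "real \<times> real \<Rightarrow> real" and T :: "point \<Rightarrow> point"
  assumes ab: "a\<^sup>2 + b\<^sup>2 = 1" and l: "linear l"
    and T: "linear T" "\<And>v. fst (T (l v, v)) = l (snd (T (l v, v)))"
  shows "snd (T (l (a, b), (a, b))) \<bullet> (a, b) + snd (T (l (- b, a), (- b, a))) \<bullet> (- b, a)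
    = trace_on {X. fst X = l (snd X)} T"
proof -
  define e1 e2 :: "real \<times> real" where e: "e1 = (a, b)" "e2 = (- b, a)"
  define X Y where XY: "X = (l e1, e1)" "Y = (l e2, e2)"
  have ip: "e1 \<bullet> e1 = 1" "e2 \<bullet> e2 = 1" "e1 \<bullet> e2 = 0"
    using ab by (simp_all add: e power2_eq_square algebra_simps)
  have decomp: "Z = (snd Z \<bullet> e1) *\<^sub>R X + (snd Z \<bullet> e2) *\<^sub>R Y" if "fst Z = l (snd Z)" for Z :: point
  proof -
    have z: "snd Z = (snd Z \<bullet> e1) *\<^sub>R e1 + (snd Z \<bullet> e2) *\<^sub>R e2"
      using rotated_basis(1)[OF ab, of "snd Z"] by (simp add: e)
    then have "l (snd Z) = (snd Z \<bullet> e1) *\<^sub>R l e1 + (snd Z \<bullet> e2) *\<^sub>R l e2"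
      by (metis linear_add[OF l] linear_scale[OF l])
    then show ?thesis using z that by (simp add: XY prod_eq_iff)
  qed
  have ne: "X \<noteq> Y" using ip by (auto simp: XY)
  have "X \<notin> span {Y}"
  proof
    assume "X \<in> span {Y}"
    then obtain k where "X = k *\<^sub>R Y" by (auto simp: span_singleton)
    then have "e1 \<bullet> e1 = k * (e1 \<bullet> e2)" by (simp add: XY)
    then show False using ip by simp
  qed
  moreover have "e2 \<noteq> 0" using ip(2) by auto
  then have "Y \<noteq> 0" by (simp add: XY prod_eq_iff)
  ultimately have ind: "independent {X, Y}"
    by (simp add: independent_insert)
  have sub: "subspace {X. fst X = l (snd X)}"
    unfolding subspace_def by (auto simp: linear_0[OF l] linear_add[OF l] linear_scale[OF l])
  have span: "span {X, Y} = {X. fst X = l (snd X)}"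
  proof
    show "span {X, Y} \<subseteq> {X. fst X = l (snd X)}"
      by (rule span_minimal[OF _ sub]) (auto simp: XY)
    have "Z \<in> span {X, Y}" if "fst Z = l (snd Z)" for Z :: point
      by (subst decomp[OF that]) (intro span_add span_scale span_base, auto)
    then show "{X. fst X = l (snd X)} \<subseteq> span {X, Y}" by blast
  qed
  have "trace_on {X. fst X = l (snd X)} T = representation {X, Y} (T X) X + representation {X, Y} (T Y) Y"
    using trace_on_basis[OF ind span T(1)] T(2) ne by (auto simp: XY)
  also have "representation {X, Y} (T X) X = snd (T X) \<bullet> e1"
    using decomp[of "T X"] T(2)[of e1] representation_pair(1)[OF ind ne] unfolding XY(1)[symmetric] by metis
  also have "representation {X, Y} (T Y) Y = snd (T Y) \<bullet> e2"
    using decomp[of "T Y"] T(2)[of e2] representation_pair(2)[OF ind ne] unfolding XY(2)[symmetric] by metis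
  finally show ?thesis by (simp add: XY e)
qed

section \<open>The unit normal and the mean curvature of a graph\<close>

context
  fixes D :: "(real \<times> real) set" and u :: "real \<times> real \<Rightarrow> real" and \<Sigma> :: "point set"
    and f :: "real \<Rightarrow> real" and N :: "point \<Rightarrow> point"
  assumes graph: "compact_graph D u \<Sigma>"
    and normal: "unit_normal_field (warped_metric f) \<Sigma> N"
begin

text \<open>Smoothness of \<open>N\<close> is given through an ambient extension \<open>G\<close>;
  regularity over the domain is obtained from \<open>G\<close> composed with the graph map.\<close>

lemma normal_extension:
  obtains W G where "open W" "\<Sigma> \<subseteq> W" "\<And>k. Ck_on k W G" "\<And>p. p \<in> \<Sigma> \<Longrightarrow> G p = N p"
  using normal unfolding unit_normal_field_def smooth_along_def smooth_on_def by blast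

lemma Ck_on_normal: "Ck_on k (interior D) (\<lambda>q. N (u q, q))"
proof -
  obtain W G where WG: "open W" "\<Sigma> \<subseteq> W" "\<And>k. Ck_on k W G" "\<And>p. p \<in> \<Sigma> \<Longrightarrow> G p = N p"
    by (rule normal_extension) blast
  have mem: "(u q, q) \<in> \<Sigma>" if "q \<in> interior D" for q
    using that interior_subset graph_memI[OF graph] by blast
  have "Ck_on k (interior D) (\<lambda>q. G (u q, q))"
    by (rule Ck_on_compose[OF _ WG(1) _ Ck_on_graph_map[OF graph] WG(3)]) (use mem WG(2) in auto)
  then show ?thesis
    using Ck_on_cong[of "interior D" "\<lambda>q. G (u q, q)" "\<lambda>q. N (u q, q)"] WG(4) mem by simp
qed

lemma continuous_on_normal: "continuous_on D (\<lambda>q. N (u q, q))"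
proof -
  obtain W G where WG: "open W" "\<Sigma> \<subseteq> W" "\<And>k. Ck_on k W G" "\<And>p. p \<in> \<Sigma> \<Longrightarrow> G p = N p"
    by (rule normal_extension) blast
  have "continuous_on D u" using graph by (simp add: compact_graph_def)
  moreover have "continuous_on W G" by (rule Ck_on_imp_continuous_on[OF WG(3)])
  moreover have "(\<lambda>q. (u q, q)) ` D \<subseteq> W" using graph_memI[OF graph] WG(2) by blast
  ultimately have "continuous_on D (\<lambda>q. G (u q, q))"
    by (intro continuous_on_compose2[of W G D "\<lambda>q. (u q, q)"] continuous_on_Pair continuous_on_id)
  then show ?thesis
    by (rule continuous_on_eq) (simp add: WG(4) graph_memI[OF graph])
qed

lemma normal_has_derivative_within:
  assumes "p \<in> \<Sigma>"
  shows "(N has_derivative frechet_derivative N (at p within \<Sigma>)) (at p within \<Sigma>)"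
proof -
  obtain W G where WG: "open W" "\<Sigma> \<subseteq> W" "\<And>k. Ck_on k W G" "\<And>p. p \<in> \<Sigma> \<Longrightarrow> G p = N p"
    by (rule normal_extension) blast
  have "G differentiable at p" using WG(2) WG(3)[of 1] assms by auto
  then obtain G' where "(G has_derivative G') (at p within \<Sigma>)"
    by (auto simp: differentiable_def intro: has_derivative_at_withinI)
  then have "(N has_derivative G') (at p within \<Sigma>)"
    by (rule has_derivative_transform[OF assms, rotated]) (simp add: WG(4))
  then show ?thesis by (metis differentiableI frechet_derivative_works)
qed

text \<open>By the chain rule, the derivative within \<open>\<Sigma>\<close> used by the covariant
  derivative turns into an ordinary one over an open set.\<close>

lemma normal_derivative_along_graph:
  assumes q: "q \<in> interior D"
  shows "frechet_derivative N (at (u q, q) within \<Sigma>) (dir_deriv v u q, v) = dir_deriv v (\<lambda>q. N (u q, q)) q"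
proof -
  let ?L = "frechet_derivative N (at (u q, q) within \<Sigma>)"
  have sub: "(\<lambda>q. (u q, q)) ` interior D \<subseteq> \<Sigma>"
    using graph_memI[OF graph] interior_subset by blast
  have "(u q, q) \<in> \<Sigma>" using sub q by blast
  then have N: "(N has_derivative ?L) (at (u q, q) within (\<lambda>q. (u q, q)) ` interior D)"
    by (intro has_derivative_subset[OF normal_has_derivative_within sub])
  have g: "((\<lambda>q. (u q, q)) has_derivative (\<lambda>v. (dir_deriv v u q, v))) (at q within interior D)"
    by (rule has_derivative_at_withinI[OF has_derivative_graph[OF graph_differentiable[OF graph q]]])
  have "((\<lambda>q. N (u q, q)) has_derivative (\<lambda>v. ?L (dir_deriv v u q, v))) (at q within interior D)"
    using diff_chain_within[OF g N] by (simp add: o_def)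
  then have "((\<lambda>q. N (u q, q)) has_derivative (\<lambda>v. ?L (dir_deriv v u q, v))) (at q)"
    unfolding at_within_open[OF q open_interior] .
  then show ?thesis by (rule dir_deriv_eqI[symmetric])
qed

lemma normal_unit:
  assumes "q \<in> D"
  shows "(fst (N (u q, q)))\<^sup>2 + exp (2 * f (u q)) * (snd (N (u q, q)) \<bullet> snd (N (u q, q))) = 1"
proof -
  have "warped_metric f (u q, q) (N (u q, q)) (N (u q, q)) = 1"
    using normal graph_memI[OF graph assms] unfolding unit_normal_field_def by blast
  then show ?thesis by (simp add: warped_metric_def power2_eq_square)
qed

lemma normal_orthogonal:
  assumes q: "q \<in> interior D"
  shows "fst (N (u q, q)) * dir_deriv v u q + exp (2 * f (u q)) * (snd (N (u q, q)) \<bullet> v) = 0"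
proof -
  have "(u q, q) \<in> \<Sigma>" by (rule graph_memI[OF graph subsetD[OF interior_subset q]])
  moreover have "(dir_deriv v u q, v) \<in> tangent_plane \<Sigma> (u q, q)"
    unfolding tangent_plane_graph[OF graph q] by simp
  ultimately have "warped_metric f (u q, q) (N (u q, q)) (dir_deriv v u q, v) = 0"
    using normal unfolding unit_normal_field_def by blast
  then show ?thesis by (simp add: warped_metric_def)
qed

text \<open>If the vertical component were 0, orthogonality to the lift of the horizontal part would
  force that part to vanish, against unit length.\<close>

lemma normal_not_horizontal:
  assumes q: "q \<in> interior D"
  shows "fst (N (u q, q)) \<noteq> 0"
proof
  assume 0: "fst (N (u q, q)) = 0"
  then have "snd (N (u q, q)) \<bullet> snd (N (u q, q)) = 0"
    using normal_orthogonal[OF q, of "snd (N (u q, q))"] by simp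
  then show False using normal_unit[of q] 0 q interior_subset by fastforce
qed

text \<open>The trace is taken in the lifted frame. The terms with \<open>deriv f\<close> come from
  the Christoffel symbols, and \<open>fst (n q)\<close> is contributed once by each frame
  vector.\<close>

lemma mean_curvature_graph:
  assumes q: "q \<in> interior D" and ab: "a\<^sup>2 + b\<^sup>2 = 1" and f: "f differentiable at (u q)"
  defines "n \<equiv> \<lambda>q. N (u q, q)"
  shows "2 * mean_curvature (warped_metric f) \<Sigma> N (u q, q) =
    - (snd (dir_deriv (a, b) n q) \<bullet> (a, b) + snd (dir_deriv (- b, a) n q) \<bullet> (- b, a)
      + deriv f (u q) * (dir_deriv (a, b) u q * (snd (n q) \<bullet> (a, b))
        + dir_deriv (- b, a) u q * (snd (n q) \<bullet> (- b, a)) + 2 * fst (n q)))"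
proof -
  let ?l = "\<lambda>v. dir_deriv v u q" and ?T = "shape_operator (warped_metric f) \<Sigma> N (u q, q)"
  let ?L = "frechet_derivative N (at (u q, q) within \<Sigma>)"
  have p: "(u q, q) \<in> \<Sigma>" using q graph_memI[OF graph] interior_subset by blast
  have T: "?T X = - (?L X + (- deriv f (u q) * exp (2 * f (u q)) * (snd X \<bullet> snd (n q)),
            deriv f (u q) *\<^sub>R (fst X *\<^sub>R snd (n q) + fst (n q) *\<^sub>R snd X)))" for X
    unfolding shape_operator_def covariant_derivative_def n_def using f
    by (simp add: levi_civita_warped_metric)
  have L: "linear ?L"
    by (rule bounded_linear.linear[OF has_derivative_bounded_linear[OF normal_has_derivative_within[OF p]]])
  then have linT: "linear ?T"
    unfolding T by (intro linearI)
      (simp_all add: linear_add[OF L] linear_scale[OF L] prod_eq_iff algebra_simps inner_add_left)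
  have l: "linear ?l"
    by (rule bounded_linear.linear[OF has_derivative_bounded_linear[OF dir_deriv_works[OF graph_differentiable[OF graph q]]]])
  have TX: "?T (?l v, v) = - (dir_deriv v n q + (- deriv f (u q) * exp (2 * f (u q)) * (v \<bullet> snd (n q)),
            deriv f (u q) *\<^sub>R (?l v *\<^sub>R snd (n q) + fst (n q) *\<^sub>R v)))" for v
    unfolding T normal_derivative_along_graph[OF q] by (simp add: n_def)
  \<comment> \<open>The shape operator has to preserve the tangent plane. Differentiating the unit
    length shows its values to be orthogonal to \<open>N\<close>, and the nonzero vertical component
    of \<open>N\<close> turns this into tangency.\<close>
  have tangent: "fst (?T (?l v, v)) = ?l (snd (?T (?l v, v)))" for v
  proof -
    let ?E = "exp (2 * f (u q))" and ?dn = "dir_deriv v n q"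
    have dn: "(n has_derivative (\<lambda>v. dir_deriv v n q)) (at q)"
      using Ck_on_normal[of 1] q by (intro dir_deriv_works) (simp add: n_def)
    have dE: "((\<lambda>q. exp (2 * f (u q))) has_derivative (\<lambda>v. ?E * (2 * (deriv f (u q) * ?l v)))) (at q)"
    proof -
      have "(f has_derivative (*) (deriv f (u q))) (at (u q))"
        using f by (metis DERIV_deriv_iff_real_differentiable has_field_derivative_def)
      from has_derivative_compose[OF dir_deriv_works[OF graph_differentiable[OF graph q]] this]
      have "((\<lambda>q. f (u q)) has_derivative (\<lambda>v. deriv f (u q) * ?l v)) (at q)" .
      then show ?thesis by (auto intro!: derivative_eq_intros)
    qed
    have "((\<lambda>q. fst (n q) * fst (n q) + exp (2 * f (u q)) * (snd (n q) \<bullet> snd (n q))) has_derivative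
      (\<lambda>v. 2 * (fst (n q) * fst (dir_deriv v n q)) + ?E * (2 * (snd (n q) \<bullet> snd (dir_deriv v n q)))
        + ?E * (2 * (deriv f (u q) * ?l v)) * (snd (n q) \<bullet> snd (n q)))) (at q)"
      by (rule has_derivative_eq_rhs[OF has_derivative_add[OF
            has_derivative_mult[OF has_derivative_fst[OF dn] has_derivative_fst[OF dn]]
            has_derivative_mult[OF dE has_derivative_inner[OF has_derivative_snd[OF dn] has_derivative_snd[OF dn]]]]])
        (simp add: fun_eq_iff inner_commute algebra_simps)
    from dir_deriv_eqI[OF this, of v]
    have "2 * (fst (n q) * fst ?dn) + ?E * (2 * (snd (n q) \<bullet> snd ?dn))
        + ?E * (2 * (deriv f (u q) * ?l v)) * (snd (n q) \<bullet> snd (n q))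
      = dir_deriv v (\<lambda>q. fst (n q) * fst (n q) + exp (2 * f (u q)) * (snd (n q) \<bullet> snd (n q))) q" by simp
    also have "\<dots> = dir_deriv v (\<lambda>q. 1) q"
      using normal_unit interior_subset[of D] q
      by (intro dir_deriv_cong_open[of "interior D"]) (auto simp: n_def power2_eq_square)
    also have "\<dots> = 0" by (simp add: dir_deriv_def)
    finally have "fst (n q) * fst ?dn + ?E * (snd (n q) \<bullet> snd ?dn)
        + ?E * deriv f (u q) * ?l v * (snd (n q) \<bullet> snd (n q)) = 0" by simp
    then have "fst (n q) * fst (?T (?l v, v)) + ?E * (snd (n q) \<bullet> snd (?T (?l v, v))) = 0"
      unfolding TX by (simp add: algebra_simps inner_add_right inner_commute)
    then have "fst (n q) * fst (?T (?l v, v)) = fst (n q) * ?l (snd (?T (?l v, v)))"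
      using normal_orthogonal[OF q, of "snd (?T (?l v, v))"] unfolding n_def by linarith
    then show ?thesis using normal_not_horizontal[OF q] by (simp add: n_def)
  qed
  have "2 * mean_curvature (warped_metric f) \<Sigma> N (u q, q) = trace_on {X. fst X = ?l (snd X)} ?T"
    unfolding mean_curvature_def tangent_plane_graph[OF graph q] by simp
  also have "\<dots> = snd (?T (?l (a, b), (a, b))) \<bullet> (a, b) + snd (?T (?l (- b, a), (- b, a))) \<bullet> (- b, a)"
    by (rule trace_on_graph_plane[OF ab l linT tangent, symmetric])
  also have "\<dots> = - (snd (dir_deriv (a, b) n q) \<bullet> (a, b) + snd (dir_deriv (- b, a) n q) \<bullet> (- b, a)
      + deriv f (u q) * (dir_deriv (a, b) u q * (snd (n q) \<bullet> (a, b))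
        + dir_deriv (- b, a) u q * (snd (n q) \<bullet> (- b, a)) + 2 * fst (n q)))"
  proof -
    have ip: "(a, b) \<bullet> (a, b) = 1" "(- b, a) \<bullet> (- b, a) = 1"
      using ab by (simp_all add: power2_eq_square algebra_simps)
    have T_v: "snd (?T (?l v, v)) \<bullet> v = - (snd (dir_deriv v n q) \<bullet> v
        + deriv f (u q) * (?l v * (snd (n q) \<bullet> v) + fst (n q) * (v \<bullet> v)))" for v
      unfolding TX by (simp add: inner_add_left inner_diff_left)
    show ?thesis unfolding T_v ip by (simp add: algebra_simps del: inner_Pair)
  qed
  finally show ?thesis .
qed

end

section \<open>Reduction of the geometric hypotheses to the locale \<open>cmc_graph\<close>\<close>

lemma smooth_real_derivatives:
  fixes f :: "real \<Rightarrow> real"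
  assumes "smooth_on UNIV f"
  shows "(f has_real_derivative deriv f t) (at t)" "(deriv f has_real_derivative deriv (deriv f) t) (at t)"
proof -
  have C: "Ck_on 2 UNIV f" using assms by (simp add: smooth_on_def)
  have f: "f differentiable at t" for t using C unfolding numeral_2_eq_2 Ck_on_Suc by simp
  then show D: "(f has_real_derivative deriv f t) (at t)" for t
    by (metis DERIV_deriv_iff_real_differentiable)
  have "dir_deriv 1 f = deriv f"
    using dir_deriv_eqI[OF D[unfolded has_field_derivative_def]] by auto
  moreover have "dir_deriv 1 f differentiable at t" using C unfolding numeral_2_eq_2 Ck_on_Suc by blast
  ultimately show "(deriv f has_real_derivative deriv (deriv f) t) (at t)"
    by (metis DERIV_deriv_iff_real_differentiable)
qed

lemma Ck_on_conformal_factor: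
  fixes f :: "real \<Rightarrow> real"
  assumes "compact_graph D u \<Sigma>" "smooth_on UNIV f"
  shows "Ck_on k (interior D) (\<lambda>q. exp (f (u q)))"
proof (rule Ck_on_compose[of "interior D" UNIV "\<lambda>q. f (u q)" k exp, OF _ _ _ _ Ck_on_exp])
  show "Ck_on k (interior D) (\<lambda>q. f (u q))"
    using assms(2) by (intro Ck_on_compose[of "interior D" UNIV u k f, OF _ _ _ Ck_on_graph[OF assms(1)]])
      (auto simp: smooth_on_def)
qed auto

lemma cmc_graph_of_compact_graph:
  assumes graph: "compact_graph D u \<Sigma>" and normal: "unit_normal_field (warped_metric f) \<Sigma> N"
    and f: "smooth_on UNIV f" and H: "\<forall>p\<in>\<Sigma>. mean_curvature (warped_metric f) \<Sigma> N p = H"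
    and ab: "a\<^sup>2 + b\<^sup>2 = 1"
  shows "cmc_graph (interior D) (a, b) (- b, a) u (\<lambda>q. fst (N (u q, q)))
    (\<lambda>q. exp (f (u q)) * (snd (N (u q, q)) \<bullet> (a, b))) (\<lambda>q. exp (f (u q)) * (snd (N (u q, q)) \<bullet> (- b, a)))
    f (deriv f) (deriv (deriv f)) H"
proof -
  define n where "n q = N (u q, q)" for q
  define m where "m e q = exp (f (u q)) * (snd (n q) \<bullet> e)" for e q
  have Ck_n: "Ck_on 2 (interior D) n"
    using Ck_on_normal[OF graph normal] by (simp add: n_def[abs_def])
  have Ck_m: "Ck_on 2 (interior D) (m e)" for e
    using Ck_on_scaleR[OF open_interior Ck_on_conformal_factor[OF graph f]
        Ck_on_bounded_linear[OF open_interior bounded_linear_compose[OF bounded_linear_inner_left bounded_linear_snd] Ck_n]]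
    by (simp add: m_def[abs_def])
  have Ck_\<theta>: "Ck_on 2 (interior D) (\<lambda>q. fst (n q))"
    by (rule Ck_on_bounded_linear[OF open_interior bounded_linear_fst Ck_n])
  have m_normal: "fst (n q) * dir_deriv e u q = - exp (f (u q)) * m e q" if "q \<in> interior D" for q e
    using normal_orthogonal[OF graph normal that, of e]
    by (simp add: m_def n_def exp_double power2_eq_square eq_neg_iff_add_eq_0 mult.assoc)
  have unit: "(fst (n q))\<^sup>2 + (m (a, b) q)\<^sup>2 + (m (- b, a) q)\<^sup>2 = 1" if "q \<in> interior D" for q
  proof -
    have "(m (a, b) q)\<^sup>2 + (m (- b, a) q)\<^sup>2
      = (exp (f (u q)))\<^sup>2 * ((snd (n q) \<bullet> (a, b))\<^sup>2 + (snd (n q) \<bullet> (- b, a))\<^sup>2)"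
      unfolding m_def power_mult_distrib by (simp only: distrib_left)
    also have "\<dots> = exp (2 * f (u q)) * (snd (n q) \<bullet> snd (n q))"
      unfolding rotated_basis(2)[OF ab] by (simp add: exp_double)
    finally show ?thesis
      using normal_unit[OF graph normal subsetD[OF interior_subset that]] unfolding n_def by linarith
  qed
  have dm: "dir_deriv e (m e) q = exp (f (u q)) *
      (deriv f (u q) * (dir_deriv e u q * (snd (n q) \<bullet> e)) + snd (dir_deriv e n q) \<bullet> e)"
    if q: "q \<in> interior D" for q e
  proof -
    have dn: "(n has_derivative (\<lambda>v. dir_deriv v n q)) (at q)"
      using Ck_n q unfolding numeral_2_eq_2 Ck_on_Suc by (blast intro: dir_deriv_works)
    have "(f has_derivative (*) (deriv f (u q))) (at (u q))"
      using smooth_real_derivatives(1)[OF f] by (simp add: has_field_derivative_def)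
    from has_derivative_compose[OF dir_deriv_works[OF graph_differentiable[OF graph q]] this]
    have "((\<lambda>q. exp (f (u q))) has_derivative (\<lambda>v. exp (f (u q)) * (deriv f (u q) * dir_deriv v u q))) (at q)"
      by (auto intro!: derivative_eq_intros)
    from dir_deriv_eqI[OF has_derivative_mult[OF this has_derivative_inner_left[OF has_derivative_snd[OF dn]]], of e e]
    show ?thesis unfolding m_def[abs_def] by (simp add: algebra_simps)
  qed
  have cmc: "dir_deriv (a, b) (m (a, b)) q + dir_deriv (- b, a) (m (- b, a)) q
      = - 2 * exp (f (u q)) * (H + deriv f (u q) * fst (n q))" if q: "q \<in> interior D" for q
  proof -
    have "f differentiable at (u q)" using smooth_real_derivatives(1)[OF f] real_differentiable_def by blast
    note mean_curvature_graph[OF graph normal q ab this]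
    moreover have "mean_curvature (warped_metric f) \<Sigma> N (u q, q) = H"
      using H graph_memI[OF graph subsetD[OF interior_subset q]] by blast
    ultimately have "2 * H = - (snd (dir_deriv (a, b) n q) \<bullet> (a, b) + snd (dir_deriv (- b, a) n q) \<bullet> (- b, a)
      + deriv f (u q) * (dir_deriv (a, b) u q * (snd (n q) \<bullet> (a, b))
        + dir_deriv (- b, a) u q * (snd (n q) \<bullet> (- b, a)) + 2 * fst (n q)))"
      by (simp only: n_def[abs_def])
    \<comment> \<open>After multiplication by the conformal factor, the products of
      \<open>deriv f\<close> with derivatives of \<open>u\<close> are absorbed by \<open>dm\<close>;
      only the term with \<open>2 * fst (n q)\<close> stays explicit.\<close>
    then have "exp (f (u q)) * (2 * H) = exp (f (u q)) * (- (snd (dir_deriv (a, b) n q) \<bullet> (a, b)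
      + snd (dir_deriv (- b, a) n q) \<bullet> (- b, a)
      + deriv f (u q) * (dir_deriv (a, b) u q * (snd (n q) \<bullet> (a, b))
        + dir_deriv (- b, a) u q * (snd (n q) \<bullet> (- b, a)) + 2 * fst (n q))))" by (rule arg_cong)
    then show ?thesis unfolding dm[OF q] by (simp add: algebra_simps del: inner_Pair)
  qed
  have "cmc_graph (interior D) (a, b) (- b, a) u (\<lambda>q. fst (n q)) (m (a, b)) (m (- b, a))
    f (deriv f) (deriv (deriv f)) H"
    using Ck_on_graph[OF graph] Ck_\<theta> Ck_m m_normal unit cmc smooth_real_derivatives[OF f]
    by unfold_locales blast+
  then show ?thesis by (simp only: n_def m_def[abs_def])
qed

text \<open>The left side is the tangent to \<open>f\<close> at \<open>h\<close>, evaluated at 0; it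
  lies below the graph by convexity.\<close>

lemma convex_tangent_bound:
  fixes f :: "real \<Rightarrow> real"
  assumes "\<And>t. (f has_real_derivative f1 t) (at t)" "\<And>t. (f1 has_real_derivative f2 t) (at t)"
    and "\<And>t. f2 t \<ge> 0" and h: "h \<ge> 0"
  shows "f h - h * f1 h \<le> f 0"
proof (cases "h = 0")
  case False
  then have "\<exists>z>0. z < h \<and> f h - f 0 = (h - 0) * f1 z"
    using h by (intro MVT2 assms(1)) auto
  then obtain z where z: "z < h" "f h - f 0 = h * f1 z" by auto
  have "f1 z \<le> f1 h"
    using DERIV_nonneg_imp_nondecreasing[of z h f1] assms z(1) by (meson less_imp_le)
  then show ?thesis using z(2) h mult_left_mono[of "f1 z" "f1 h" h] by linarith
qed simp

section \<open>The height estimate\<close>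

theorem theorem1p2:
  fixes f :: "real \<Rightarrow> real"
    and D :: "(real \<times> real) set" and u :: "real \<times> real \<Rightarrow> real"
    and \<Sigma> :: "point set" and N :: "point \<Rightarrow> point" and H :: real
  assumes "smooth_on UNIV f"
    and "\<forall>t. f t \<ge> 0" and "\<forall>t. deriv f t \<le> 0" and "\<forall>t. deriv (deriv f) t \<ge> 0"
    and "compact_graph D u \<Sigma>"
    and "unit_normal_field (warped_metric f) \<Sigma> N"
    and "H > 0" and "\<forall>p\<in>\<Sigma>. mean_curvature (warped_metric f) \<Sigma> N p = H"
    and "surface_boundary \<Sigma> \<subseteq> {0} \<times> UNIV"
  shows "\<forall>p\<in>\<Sigma>. height p \<le> exp (f 0) / H"
proof -
  note f = assms(1) and graph = assms(5) and normal = assms(6)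
  note df = smooth_real_derivatives[OF f]
  note cmc = cmc_graph_of_compact_graph[OF graph normal f assms(8)]
  define \<theta> where "\<theta> q = fst (N (u q, q))" for q
  have D: "compact D" "interior D \<noteq> {}" "connected (interior D)" "closure (interior D) = D"
    and cont_u: "continuous_on D u"
    using graph by (simp_all add: compact_graph_def compact_domain_def)
  have int: "interior D \<subseteq> D" by (rule interior_subset)
  have D_ne: "D \<noteq> {}" using D(2) int by blast
  have boundary: "u q = 0" if "q \<in> D" "q \<notin> interior D" for q
    using frontier_in_surface_boundary[OF graph that] assms(9) by auto
  have cont_\<theta>: "continuous_on D \<theta>"
    unfolding \<theta>_def by (intro continuous_on_fst continuous_on_normal[OF graph normal])
  have \<theta>_ge: "\<theta> q \<ge> - 1" if "q \<in> D" for q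
  proof -
    have "0 \<le> exp (2 * f (u q)) * (snd (N (u q, q)) \<bullet> snd (N (u q, q)))" by simp
    then have "(\<theta> q)\<^sup>2 \<le> 1"
      using normal_unit[OF graph normal that] unfolding \<theta>_def by linarith
    then show ?thesis by (simp add: abs_square_le_1 abs_le_iff)
  qed
  have mono: "f t \<le> f 0" if "t \<ge> 0" for t
    using DERIV_nonpos_imp_nonincreasing[OF that, of f] df(1) assms(3) by blast
  have sign: "(\<forall>q\<in>interior D. \<theta> q > 0) \<or> (\<forall>q\<in>interior D. \<theta> q < 0)"
  proof (rule ccontr)
    have ne: "\<theta> q \<noteq> 0" if "q \<in> interior D" for q
      using normal_not_horizontal[OF graph normal that] by (simp add: \<theta>_def)
    assume "\<not> ?thesis"
    then obtain q q' where "q \<in> interior D" "q' \<in> interior D" "\<theta> q < 0" "\<theta> q' > 0"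
      using ne by (metis linorder_neqE_linordered_idom)
    moreover have "connected (\<theta> ` interior D)"
      using D(3) continuous_on_subset[OF cont_\<theta> int] connected_continuous_image by blast
    ultimately have "0 \<in> \<theta> ` interior D"
      using connectedD_interval[of "\<theta> ` interior D" "\<theta> q" "\<theta> q'" 0] by auto
    then show False using ne by auto
  qed
  have main: "H * u q \<le> exp (f 0)" if q: "q \<in> D" for q
    using sign
  proof
    assume pos: "\<forall>q\<in>interior D. \<theta> q > 0"
    obtain x where x: "x \<in> D" "\<And>y. y \<in> D \<Longrightarrow> u y \<le> u x"
      using continuous_attains_sup[OF D(1) D_ne cont_u] by blast
    show ?thesis
    proof (cases "u x \<le> 0")
      case True
      then have "u q \<le> 0" using x(2)[OF q] by simp
      then have "H * u q \<le> 0" using assms(7) by (simp add: mult_nonneg_nonpos)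
      then show ?thesis by (rule order_trans) simp
    next
      case False
      then have xi: "x \<in> interior D" using boundary[OF x(1)] by linarith
      interpret cmc_graph "interior D" "(1, 0)" "(- 0, 1)" u "\<lambda>q. fst (N (u q, q))"
        "\<lambda>q. exp (f (u q)) * (snd (N (u q, q)) \<bullet> (1, 0))" "\<lambda>q. exp (f (u q)) * (snd (N (u q, q)) \<bullet> (- 0, 1))"
        f "deriv f" "deriv (deriv f)" H
        by (rule cmc) simp
      have "H \<le> - deriv f (u x)"
        using x(2) int pos xi by (intro curvature_at_max) (auto simp: \<theta>_def)
      then have "u x * H \<le> u x * (- deriv f (u x))"
        using False by (intro mult_left_mono) auto
      also have "\<dots> \<le> f 0 - f (u x)"
        using convex_tangent_bound[OF df, of "u x"] assms(4) False by simp
      also have "\<dots> \<le> exp (f 0)"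
        using assms(2) exp_ge_add_one_self[of "f 0"] by (smt (verit))
      finally have "u x * H \<le> exp (f 0)" .
      moreover have "u q * H \<le> u x * H" using x(2)[OF q] assms(7) by simp
      ultimately show ?thesis by (simp add: mult.commute)
    qed
  next
    assume neg: "\<forall>q\<in>interior D. \<theta> q < 0"
    \<comment> \<open>The sign passes to the frontier by continuity, since \<open>D\<close> is the
      closure of its interior; \<open>\<theta>\<close> may vanish there, at vertical tangent
      planes.\<close>
    have \<theta>_le: "\<theta> q \<le> 0" if "q \<in> D" for q
      using continuous_le_on_closure[of "interior D" \<theta> q 0] cont_\<theta> D(4) that neg by fastforce
    \<comment> \<open>The strict inequality \<open>c < H\<close> is what lets
      \<open>no_interior_max\<close> exclude an interior maximum; \<open>c\<close> is chosen close
      enough to \<open>H\<close> at the end.\<close>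
    have bound: "c * u q \<le> exp (f (u q))" if c: "0 < c" "c < H" for c
    proof -
      define \<phi> where "\<phi> q = c * u q + exp (f (u q)) * \<theta> q" for q
      have "continuous_on D (\<lambda>q. f (u q))"
        using DERIV_isCont[OF df(1)] cont_u
        by (intro continuous_on_compose2[OF continuous_at_imp_continuous_on[of UNIV f]]) auto
      then have "continuous_on D \<phi>"
        unfolding \<phi>_def using cont_u cont_\<theta> by (intro continuous_intros)
      then obtain x where x: "x \<in> D" "\<And>y. y \<in> D \<Longrightarrow> \<phi> y \<le> \<phi> x"
        using continuous_attains_sup[OF D(1) D_ne] by blast
      have xi: "x \<notin> interior D"
      proof
        assume xi: "x \<in> interior D"
        \<comment> \<open>\<open>(a, b)\<close> is the unit vector along the horizontal part of
          \<open>N\<close> at \<open>x\<close>, or \<open>(1, 0)\<close> if that part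
          vanishes.\<close>
        obtain a b where ab: "a\<^sup>2 + b\<^sup>2 = 1" and 0: "snd (N (u x, x)) \<bullet> (- b, a) = 0"
        proof (cases "snd (N (u x, x)) = 0")
          case True
          then show thesis using that[of 1 0] by simp
        next
          case False
          obtain s t where st: "snd (N (u x, x)) = (s, t)" by fastforce
          define r where "r = sqrt (s\<^sup>2 + t\<^sup>2)"
          have "s\<^sup>2 + t\<^sup>2 > 0" using False st by (auto simp: sum_power2_gt_zero_iff zero_prod_def)
          then have r: "r > 0" "r\<^sup>2 = s\<^sup>2 + t\<^sup>2" by (simp_all add: r_def)
          have "(s / r)\<^sup>2 + (t / r)\<^sup>2 = r\<^sup>2 / r\<^sup>2"
            unfolding r(2) power_divide by (rule add_divide_distrib[symmetric])
          then have "(s / r)\<^sup>2 + (t / r)\<^sup>2 = 1" using r(1) by simp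
          then show thesis by (rule that) (simp add: st)
        qed
        interpret cmc_graph "interior D" "(a, b)" "(- b, a)" u "\<lambda>q. fst (N (u q, q))"
          "\<lambda>q. exp (f (u q)) * (snd (N (u q, q)) \<bullet> (a, b))" "\<lambda>q. exp (f (u q)) * (snd (N (u q, q)) \<bullet> (- b, a))"
          f "deriv f" "deriv (deriv f)" H
          by (rule cmc[OF ab])
        show False
        proof (rule no_interior_max[OF xi _ _ _ c])
          show "c * u y + exp (f (u y)) * fst (N (u y, y)) \<le> c * u x + exp (f (u x)) * fst (N (u x, x))"
            if "y \<in> interior D" for y
            using x(2)[of y] that int by (auto simp: \<phi>_def \<theta>_def)
        qed (use 0 neg xi assms(2-4) Ck_on_conformal_factor[OF graph f] in \<open>auto simp: \<theta>_def simp del: inner_Pair\<close>)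
      qed
      have "\<phi> q \<le> \<phi> x" by (rule x(2)[OF q])
      \<comment> \<open>Over the frontier \<open>u\<close> is 0, which leaves only the term with the
        nonpositive factor \<open>\<theta> x\<close>.\<close>
      also have "\<phi> x \<le> 0"
        using boundary[OF x(1) xi] \<theta>_le[OF x(1)] by (simp add: \<phi>_def mult_nonneg_nonpos)
      finally have "c * u q \<le> exp (f (u q)) * (- \<theta> q)" by (simp add: \<phi>_def)
      also have "\<dots> \<le> exp (f (u q)) * 1"
        using \<theta>_ge[OF q] by (intro mult_left_mono) auto
      finally show ?thesis by simp
    qed
    show ?thesis
    proof (rule ccontr)
      assume "\<not> H * u q \<le> exp (f 0)"
      then have H: "exp (f 0) < H * u q" by simp
      have "0 < exp (f 0)" by simp
      with H have "0 < H * u q" by (rule less_trans[rotated])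
      then have u: "u q > 0" using assms(7) by (simp add: zero_less_mult_iff)
      then have "exp (f 0) / u q < H" using H by (simp add: pos_divide_less_eq)
      \<comment> \<open>If the estimate fails, there is room for such a \<open>c\<close> below
        \<open>H\<close>; then \<open>c * u q\<close> exceeds \<open>exp (f 0)\<close>, whereas
        \<open>bound\<close> and the monotonicity of \<open>f\<close> give the opposite.\<close>
      then obtain c where c: "exp (f 0) / u q < c" "c < H" using dense by blast
      moreover have "0 < exp (f 0) / u q" using u by simp
      ultimately have "c * u q \<le> exp (f (u q))" by (intro bound) auto
      also have "\<dots> \<le> exp (f 0)" using mono[of "u q"] u by simp
      finally show False using c(1) u by (simp add: pos_divide_less_eq)
    qed
  qed
  show ?thesis
  proof
    fix p assume "p \<in> \<Sigma>"
    then have "snd p \<in> D" "fst p = u (snd p)" by (auto simp: graph_eq[OF graph])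
    then show "height p \<le> exp (f 0) / H"
      using main[of "snd p"] assms(7) by (simp add: height_def pos_le_divide_eq mult.commute)
  qed
qed

end
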